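(* Let $K$ be a ring with unit and let $A$ be a $K$-algebra having a Boolean-Cartan semigroup $B$ (with respect to projections $P\subseteq B$). Then $KB_0/I$ is isomorphic to $A$ via the unique algebra homomorphism sending each $\delta_b+I$ to $b$, $b\in B$.
   Context: **Restriction semigroups.** Let $B$ be a semigroup with a distinguished commutative subsemigroup $P$ of idempotents ("projections"). Write $a\leq b$ iff $a=bp$ for some $p\in P$; $\mathsf s(a)=\min\{p\in P:ap=a\}$ if it exists. $B$ is a restriction semigroup relative to $P$ if every element has a source projection $\mathsf s(a)$ (then $\leq$ is a partial order), $\mathsf s(ab)=\mathsf s(\mathsf s(a)b)$ for all $a,b\in B$, and $pb\leq b$ for all $p\in P$, $b\in B$. Write $a^{\geq}=\{c\in B:c\leq a\}$. **Boolean-Cartan.** A $K$-algebra ($K$ possibly non-commutative) is a $K$-bimodule with a product distributive over addition and associative (including with scalars in any position). Let $A$ be a $K$-algebra and $B\subseteq A$ a multiplicative subsemigroup commuting with $K$ ($kb=bk$), generating $A$ as an algebra, which is a restriction semigroup with respect to $P\subseteq B$. $B$ is Boolean-Cartan if: (i) $kb\neq0$ whenever $k\in K\setminus\{0\}$, $b\in B\setminus\{0\}$; (ii) $p\leq q\in P$ implies $q-p\in P$; (iii) there is an operation $\wedge:A\times B\to A$, linear (additive, left and right $K$-linear) in the $A$ variable, such that $a\wedge b=\max(a^{\geq}\cap b^{\geq})$ for all $a,b\in B$. In this case $0\in P$ is the minimum of $(B,\leq)$, binary meets exist in $B$, every principal ideal $b^\geq$ is a Boolean algebra, and any $a,b\in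 B$ with a common upper bound have a join $a\vee b$ in $B$. **The algebra $KB_0/I$.** Let $B_0=B\setminus\{0\}$. $KB_0$ is the $K$-bimodule of finitely supported functions $B_0\to K$ (pointwise operations), with $\delta_b$ the indicator of $b\in B_0$ and $\delta_0$ the zero function, made into a $K$-algebra by $\delta_a\delta_b=\delta_{ab}$ (with the $\delta_b$ commuting with scalars). Elements $a,b\in B$ are orthogonal if $a\mathsf s(b)=0$ (equivalently $\mathsf s(a)\mathsf s(b)=0$), and bounded if they have a common upper bound in $B$. $I$ is the ideal \[I=\mathrm{span}\{\delta_a+\delta_b-\delta_{a\vee b}: a,b\in B_0\text{ orthogonal and bounded}\}.\] *)

theory Defs
  imports "HOL-Algebra.Module" "HOL-Algebra.QuotRing"
begin

section \<open>Algebras over a possibly non-commutative ring\<close>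

text \<open>
  An algebra is a unital bimodule with a compatible product.  It need not have a multiplicative
  unit: the field \<open>one\<close>, which is present only because the record extends that of modules, is
  never referred to.
\<close>

record ('k, 'a) bimodule = "('k, 'a) module" +
  rsmult :: "['a, 'k] \<Rightarrow> 'a" (infixl \<open>\<star>\<index>\<close> 70)

locale K_algebra = K?: ring K + A?: abelian_group A
  for K :: "('k, 'm) ring_scheme" and A :: "('k, 'a, 'n) bimodule_scheme" (structure) +
  assumes lsmult_closed: "\<lbrakk>k \<in> carrier K; x \<in> carrier A\<rbrakk> \<Longrightarrow> k \<odot> x \<in> carrier A"
    and lsmult_l_distr: "\<lbrakk>k \<in> carrier K; l \<in> carrier K; x \<in> carrier A\<rbrakk>
        \<Longrightarrow> (k \<oplus>\<^bsub>K\<^esub> l) \<odot> x = k \<odot> x \<oplus> l \<odot> x"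
    and lsmult_r_distr: "\<lbrakk>k \<in> carrier K; x \<in> carrier A; y \<in> carrier A\<rbrakk>
        \<Longrightarrow> k \<odot> (x \<oplus> y) = k \<odot> x \<oplus> k \<odot> y"
    and lsmult_assoc: "\<lbrakk>k \<in> carrier K; l \<in> carrier K; x \<in> carrier A\<rbrakk>
        \<Longrightarrow> (k \<otimes>\<^bsub>K\<^esub> l) \<odot> x = k \<odot> (l \<odot> x)"
    and lsmult_one: "x \<in> carrier A \<Longrightarrow> \<one>\<^bsub>K\<^esub> \<odot> x = x"
    and rsmult_closed: "\<lbrakk>k \<in> carrier K; x \<in> carrier A\<rbrakk> \<Longrightarrow> x \<star> k \<in> carrier A"
    and rsmult_r_distr: "\<lbrakk>k \<in> carrier K; l \<in> carrier K; x \<in> carrier A\<rbrakk>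
        \<Longrightarrow> x \<star> (k \<oplus>\<^bsub>K\<^esub> l) = x \<star> k \<oplus> x \<star> l"
    and rsmult_l_distr: "\<lbrakk>k \<in> carrier K; x \<in> carrier A; y \<in> carrier A\<rbrakk>
        \<Longrightarrow> (x \<oplus> y) \<star> k = x \<star> k \<oplus> y \<star> k"
    and rsmult_assoc: "\<lbrakk>k \<in> carrier K; l \<in> carrier K; x \<in> carrier A\<rbrakk>
        \<Longrightarrow> x \<star> (k \<otimes>\<^bsub>K\<^esub> l) = (x \<star> k) \<star> l"
    and rsmult_one: "x \<in> carrier A \<Longrightarrow> x \<star> \<one>\<^bsub>K\<^esub> = x"
    and lsmult_rsmult: "\<lbrakk>k \<in> carrier K; l \<in> carrier K; x \<in> carrier A\<rbrakk>
        \<Longrightarrow> (k \<odot> x) \<star> l = k \<odot> (x \<star> l)"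
    and mult_closed: "\<lbrakk>x \<in> carrier A; y \<in> carrier A\<rbrakk> \<Longrightarrow> x \<otimes> y \<in> carrier A"
    and mult_l_distr: "\<lbrakk>x \<in> carrier A; y \<in> carrier A; z \<in> carrier A\<rbrakk>
        \<Longrightarrow> (x \<oplus> y) \<otimes> z = x \<otimes> z \<oplus> y \<otimes> z"
    and mult_r_distr: "\<lbrakk>x \<in> carrier A; y \<in> carrier A; z \<in> carrier A\<rbrakk>
        \<Longrightarrow> z \<otimes> (x \<oplus> y) = z \<otimes> x \<oplus> z \<otimes> y"
    and mult_assoc: "\<lbrakk>x \<in> carrier A; y \<in> carrier A; z \<in> carrier A\<rbrakk>
        \<Longrightarrow> (x \<otimes> y) \<otimes> z = x \<otimes> (y \<otimes> z)"
    and lsmult_mult: "\<lbrakk>k \<in> carrier K; x \<in> carrier A; y \<in> carrier A\<rbrakk>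
        \<Longrightarrow> (k \<odot> x) \<otimes> y = k \<odot> (x \<otimes> y)"
    and rsmult_mult: "\<lbrakk>k \<in> carrier K; x \<in> carrier A; y \<in> carrier A\<rbrakk>
        \<Longrightarrow> (x \<star> k) \<otimes> y = x \<otimes> (k \<odot> y)"
    and mult_rsmult: "\<lbrakk>k \<in> carrier K; x \<in> carrier A; y \<in> carrier A\<rbrakk>
        \<Longrightarrow> (x \<otimes> y) \<star> k = x \<otimes> (y \<star> k)"

locale K_algebra_hom = source: K_algebra K M + target: K_algebra K N
  for K :: "('k, 'm) ring_scheme"
    and M :: "('k, 'a, 'n) bimodule_scheme" and N :: "('k, 'b, 'o) bimodule_scheme" +
  fixes h :: "'a \<Rightarrow> 'b"
  assumes hom_closed: "h \<in> carrier M \<rightarrow> carrier N"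
    and hom_add: "\<lbrakk>x \<in> carrier M; y \<in> carrier M\<rbrakk> \<Longrightarrow> h (x \<oplus>\<^bsub>M\<^esub> y) = h x \<oplus>\<^bsub>N\<^esub> h y"
    and hom_mult: "\<lbrakk>x \<in> carrier M; y \<in> carrier M\<rbrakk> \<Longrightarrow> h (x \<otimes>\<^bsub>M\<^esub> y) = h x \<otimes>\<^bsub>N\<^esub> h y"
    and hom_lsmult: "\<lbrakk>k \<in> carrier K; x \<in> carrier M\<rbrakk> \<Longrightarrow> h (k \<odot>\<^bsub>M\<^esub> x) = k \<odot>\<^bsub>N\<^esub> h x"
    and hom_rsmult: "\<lbrakk>k \<in> carrier K; x \<in> carrier M\<rbrakk> \<Longrightarrow> h (x \<star>\<^bsub>M\<^esub> k) = h x \<star>\<^bsub>N\<^esub> k"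

definition sub_bimodule ::
    "('k, 'm) ring_scheme \<Rightarrow> ('k, 'a, 'n) bimodule_scheme \<Rightarrow> 'a set \<Rightarrow> bool" where
  "sub_bimodule K M N \<longleftrightarrow> additive_subgroup N M \<and>
     (\<forall>k\<in>carrier K. \<forall>x\<in>N. k \<odot>\<^bsub>M\<^esub> x \<in> N \<and> x \<star>\<^bsub>M\<^esub> k \<in> N)"

definition K_span ::
    "('k, 'm) ring_scheme \<Rightarrow> ('k, 'a, 'n) bimodule_scheme \<Rightarrow> 'a set \<Rightarrow> 'a set" where
  "K_span K M S = \<Inter>{N. sub_bimodule K M N \<and> S \<subseteq> N}"

definition generated_subalgebra ::
    "('k, 'm) ring_scheme \<Rightarrow> ('k, 'a, 'n) bimodule_scheme \<Rightarrow> 'a set \<Rightarrow> 'a set" where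
  "generated_subalgebra K A S =
     \<Inter>{N. sub_bimodule K A N \<and> (\<forall>x\<in>N. \<forall>y\<in>N. x \<otimes>\<^bsub>A\<^esub> y \<in> N) \<and> S \<subseteq> N}"

text \<open>The ring operations are those of \<^const>\<open>FactRing\<close>.\<close>

definition quotient_algebra ::
    "('k, 'a, 'n) bimodule_scheme \<Rightarrow> 'a set \<Rightarrow> ('k, 'a set) bimodule" where
  "quotient_algebra M I =
     \<lparr>carrier = a_rcosets\<^bsub>M\<^esub> I, mult = rcoset_mult M I, one = I +>\<^bsub>M\<^esub> \<one>\<^bsub>M\<^esub>,
      zero = I, add = set_add M,
      smult = (\<lambda>k X. \<Union>x\<in>X. I +>\<^bsub>M\<^esub> (k \<odot>\<^bsub>M\<^esub> x)),
      rsmult = (\<lambda>X k. \<Union>x\<in>X. I +>\<^bsub>M\<^esub> (x \<star>\<^bsub>M\<^esub> k))\<rparr>"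


section \<open>Restriction semigroups\<close>

text \<open>
  A semigroup is given by the fields \<open>carrier\<close> and \<open>mult\<close> of a monoid record; the field \<open>one\<close>
  is ignored.
\<close>

definition rs_le :: "('a, 'm) monoid_scheme \<Rightarrow> 'a set \<Rightarrow> 'a \<Rightarrow> 'a \<Rightarrow> bool" where
  "rs_le G P a b \<longleftrightarrow> (\<exists>p\<in>P. a = b \<otimes>\<^bsub>G\<^esub> p)"

definition is_source :: "('a, 'm) monoid_scheme \<Rightarrow> 'a set \<Rightarrow> 'a \<Rightarrow> 'a \<Rightarrow> bool" where
  "is_source G P a p \<longleftrightarrow> p \<in> P \<and> a \<otimes>\<^bsub>G\<^esub> p = a \<and> (\<forall>q\<in>P. a \<otimes>\<^bsub>G\<^esub> q = a \<longrightarrow> rs_le G P p q)"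

definition source :: "('a, 'm) monoid_scheme \<Rightarrow> 'a set \<Rightarrow> 'a \<Rightarrow> 'a" where
  "source G P a = (THE p. is_source G P a p)"

definition down_set :: "('a, 'm) monoid_scheme \<Rightarrow> 'a set \<Rightarrow> 'a \<Rightarrow> 'a set" where
  "down_set G P a = {c \<in> carrier G. rs_le G P c a}"

definition is_max :: "('a, 'm) monoid_scheme \<Rightarrow> 'a set \<Rightarrow> 'a \<Rightarrow> 'a set \<Rightarrow> bool" where
  "is_max G P m S \<longleftrightarrow> m \<in> S \<and> (\<forall>c\<in>S. rs_le G P c m)"

definition is_join :: "('a, 'm) monoid_scheme \<Rightarrow> 'a set \<Rightarrow> 'a \<Rightarrow> 'a \<Rightarrow> 'a \<Rightarrow> bool" where
  "is_join G P a b j \<longleftrightarrow> j \<in> carrier G \<and> rs_le G P a j \<and> rs_le G P b j \<and>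
     (\<forall>u\<in>carrier G. rs_le G P a u \<and> rs_le G P b u \<longrightarrow> rs_le G P j u)"

definition rs_join :: "('a, 'm) monoid_scheme \<Rightarrow> 'a set \<Rightarrow> 'a \<Rightarrow> 'a \<Rightarrow> 'a" where
  "rs_join G P a b = (THE j. is_join G P a b j)"

definition bounded_pair :: "('a, 'm) monoid_scheme \<Rightarrow> 'a set \<Rightarrow> 'a \<Rightarrow> 'a \<Rightarrow> bool" where
  "bounded_pair G P a b \<longleftrightarrow> (\<exists>c\<in>carrier G. rs_le G P a c \<and> rs_le G P b c)"

locale restriction_semigroup =
  fixes G :: "('a, 'm) monoid_scheme" (structure) and P :: "'a set"
  assumes closed: "\<lbrakk>a \<in> carrier G; b \<in> carrier G\<rbrakk> \<Longrightarrow> a \<otimes> b \<in> carrier G"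
    and assoc: "\<lbrakk>a \<in> carrier G; b \<in> carrier G; c \<in> carrier G\<rbrakk> \<Longrightarrow> (a \<otimes> b) \<otimes> c = a \<otimes> (b \<otimes> c)"
    and proj_subset: "P \<subseteq> carrier G"
    and proj_closed: "\<lbrakk>p \<in> P; q \<in> P\<rbrakk> \<Longrightarrow> p \<otimes> q \<in> P"
    and proj_comm: "\<lbrakk>p \<in> P; q \<in> P\<rbrakk> \<Longrightarrow> p \<otimes> q = q \<otimes> p"
    and proj_idem: "p \<in> P \<Longrightarrow> p \<otimes> p = p"
    and source_exists: "a \<in> carrier G \<Longrightarrow> \<exists>p. is_source G P a p"
    and source_mult: "\<lbrakk>a \<in> carrier G; b \<in> carrier G\<rbrakk>
        \<Longrightarrow> source G P (a \<otimes> b) = source G P (source G P a \<otimes> b)"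
    and proj_mult_le: "\<lbrakk>p \<in> P; b \<in> carrier G\<rbrakk> \<Longrightarrow> rs_le G P (p \<otimes> b) b"


section \<open>Boolean-Cartan semigroups\<close>

locale boolean_cartan = K_algebra K A + B: restriction_semigroup "A\<lparr>carrier := B\<rparr>" P
  for K :: "('k, 'm) ring_scheme" and A :: "('k, 'a, 'n) bimodule_scheme" (structure)
    and B P :: "'a set" +
  assumes B_subset: "B \<subseteq> carrier A"
    and B_scalar_comm: "\<lbrakk>k \<in> carrier K; b \<in> B\<rbrakk> \<Longrightarrow> k \<odot> b = b \<star> k"
    and B_generates: "generated_subalgebra K A B = carrier A"
    and scalar_mult_nonzero:
      "\<lbrakk>k \<in> carrier K - {\<zero>\<^bsub>K\<^esub>}; b \<in> B - {\<zero>}\<rbrakk> \<Longrightarrow> k \<odot> b \<noteq> \<zero>"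
    and proj_diff:
      "\<lbrakk>p \<in> P; q \<in> P; rs_le (A\<lparr>carrier := B\<rparr>) P p q\<rbrakk> \<Longrightarrow> q \<ominus> p \<in> P"
    and meet_exists:
      "\<exists>meet. (\<forall>x\<in>carrier A. \<forall>b\<in>B. meet x b \<in> carrier A) \<and>
         (\<forall>x\<in>carrier A. \<forall>y\<in>carrier A. \<forall>b\<in>B. meet (x \<oplus> y) b = meet x b \<oplus> meet y b) \<and>
         (\<forall>k\<in>carrier K. \<forall>x\<in>carrier A. \<forall>b\<in>B.
            meet (k \<odot> x) b = k \<odot> meet x b \<and> meet (x \<star> k) b = meet x b \<star> k) \<and>
         (\<forall>a\<in>B. \<forall>b\<in>B. is_max (A\<lparr>carrier := B\<rparr>) P (meet a b)
            (down_set (A\<lparr>carrier := B\<rparr>) P a \<inter> down_set (A\<lparr>carrier := B\<rparr>) P b))"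


section \<open>The contracted semigroup algebra and its quotient\<close>

text \<open>
  Functions on \<open>B - {\<zero>}\<close> are represented as functions on the whole type that vanish elsewhere.
  Their product is the bilinear extension of \<open>\<delta>\<^sub>a \<delta>\<^sub>b = \<delta>\<^sub>a\<^sub>b\<close> with \<open>\<delta>\<close> of zero being zero, hence
  the convolution discards the pairs whose product in \<open>A\<close> is zero.
\<close>

definition nonzero_support :: "('k, 'm) ring_scheme \<Rightarrow> ('a \<Rightarrow> 'k) \<Rightarrow> 'a set" where
  "nonzero_support K f = {x. f x \<noteq> \<zero>\<^bsub>K\<^esub>}"

definition contracted_algebra ::
    "('k, 'm) ring_scheme \<Rightarrow> ('k, 'a, 'n) bimodule_scheme \<Rightarrow> 'a set \<Rightarrow> ('k, 'a \<Rightarrow> 'k) bimodule"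
  where
  "contracted_algebra K A B =
     \<lparr>carrier = {f. (\<forall>x. f x \<in> carrier K) \<and> finite (nonzero_support K f) \<and>
                   nonzero_support K f \<subseteq> B - {\<zero>\<^bsub>A\<^esub>}},
      mult = (\<lambda>f g c. if c \<in> B - {\<zero>\<^bsub>A\<^esub>}
        then finsum K (\<lambda>(a, b). f a \<otimes>\<^bsub>K\<^esub> g b)
          {(a, b). a \<in> nonzero_support K f \<and> b \<in> nonzero_support K g \<and> a \<otimes>\<^bsub>A\<^esub> b = c}
        else \<zero>\<^bsub>K\<^esub>),
      one = undefined,
      zero = (\<lambda>x. \<zero>\<^bsub>K\<^esub>),
      add = (\<lambda>f g x. f x \<oplus>\<^bsub>K\<^esub> g x),
      smult = (\<lambda>k f x. k \<otimes>\<^bsub>K\<^esub> f x),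
      rsmult = (\<lambda>f k x. f x \<otimes>\<^bsub>K\<^esub> k)\<rparr>"

definition delta ::
    "('k, 'm) ring_scheme \<Rightarrow> ('k, 'a, 'n) bimodule_scheme \<Rightarrow> 'a \<Rightarrow> 'a \<Rightarrow> 'k" where
  "delta K A b = (\<lambda>x. if x = b \<and> b \<noteq> \<zero>\<^bsub>A\<^esub> then \<one>\<^bsub>K\<^esub> else \<zero>\<^bsub>K\<^esub>)"

definition join_ideal ::
    "('k, 'm) ring_scheme \<Rightarrow> ('k, 'a, 'n) bimodule_scheme \<Rightarrow> 'a set \<Rightarrow> 'a set \<Rightarrow> ('a \<Rightarrow> 'k) set"
  where
  "join_ideal K A B P = (let M = contracted_algebra K A B; G = A\<lparr>carrier := B\<rparr> in
     K_span K M
       {delta K A a \<oplus>\<^bsub>M\<^esub> delta K A b \<ominus>\<^bsub>M\<^esub> delta K A (rs_join G P a b) | a b.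
          a \<in> B - {\<zero>\<^bsub>A\<^esub>} \<and> b \<in> B - {\<zero>\<^bsub>A\<^esub>} \<and>
          a \<otimes>\<^bsub>G\<^esub> source G P b = \<zero>\<^bsub>A\<^esub> \<and> bounded_pair G P a b})"

end

theory Submission
  imports Defs
begin

text \<open>
  The evaluation map \<open>\<delta>\<^sub>b \<mapsto> b\<close> from the contracted algebra onto \<open>A\<close> is multiplicative, so everything
  reduces to identifying its kernel with the join ideal.  The join of two orthogonal bounded elements
  of \<open>B\<close> is their sum in \<open>A\<close>, which gives one inclusion.  Conversely, let \<open>f\<close> be in the kernel, and
  argue by induction on the size of its support.  For \<open>c\<close> in the support, each \<open>b\<close> is the orthogonal
  join of \<open>b \<and> c\<close> and \<open>b - b \<and> c\<close>, so modulo the join ideal \<open>f\<close> splits into a lower part supported on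
  the elements \<open>b \<and> c\<close> and an upper part supported on the elements \<open>b - b \<and> c\<close>.  Linearity of the meet
  puts both parts in the kernel.  The upper part has lost the term at \<open>c\<close>.  The lower part
  has a smaller support too if some other \<open>b\<close> in the support lies above \<open>c\<close>, since then
  \<open>b \<and> c = c \<and> c\<close>; otherwise its support, unless already smaller, contains \<open>c\<close> and a further element
  below \<open>c\<close>, so that a second splitting applies.
\<close>

section \<open>Additive maps\<close>

lemma abelian_group_hom_intro:
  assumes "abelian_group G" "abelian_group H"
    and "\<And>x. x \<in> carrier G \<Longrightarrow> h x \<in> carrier H"
    and "\<And>x y. \<lbrakk>x \<in> carrier G; y \<in> carrier G\<rbrakk> \<Longrightarrow> h (x \<oplus>\<^bsub>G\<^esub> y) = h x \<oplus>\<^bsub>H\<^esub> h y"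
  shows "abelian_group_hom G H h"
  using assms
  by (intro abelian_group_homI)
    (auto simp: group_hom_def group_hom_axioms_def hom_def intro: abelian_group.a_group)

lemma (in abelian_group_hom) hom_finsum:
  assumes "f \<in> S \<rightarrow> carrier G"
  shows "h (finsum G f S) = (\<Oplus>\<^bsub>H\<^esub>i\<in>S. h (f i))"
  using assms
proof (induction S rule: infinite_finite_induct)
  case (insert x S)
  then have "f \<in> S \<rightarrow> carrier G" "f x \<in> carrier G" by auto
  with insert show ?case
    by (simp add: G.finsum_insert H.finsum_insert G.finsum_closed Pi_iff)
qed (simp_all add: G.finsum_infinite H.finsum_infinite)

lemma (in abelian_group) add_diff_cancel:
  assumes "x \<in> carrier G" "y \<in> carrier G" shows "x \<oplus> (y \<ominus> x) = y"
  using assms a_lcomm[of x y "\<ominus> x"] by (simp add: a_minus_def r_neg)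

text \<open>Bridges two notations: a subgroup of the additive monoid is phrased with multiplicative
  names, whereas kernels, spans and images below are checked in terms of zero, sums and
  negatives.\<close>

lemma (in abelian_group) additive_subgroup_intro:
  assumes "N \<subseteq> carrier G" "\<zero> \<in> N"
    and "\<And>x y. \<lbrakk>x \<in> N; y \<in> N\<rbrakk> \<Longrightarrow> x \<oplus> y \<in> N" "\<And>x. x \<in> N \<Longrightarrow> \<ominus> x \<in> N"
  shows "additive_subgroup N G"
  using assms by (intro additive_subgroupI subgroup.intro) (auto simp: a_inv_def)

lemma (in additive_subgroup) finsum_mem:
  assumes "abelian_group G" "f \<in> S \<rightarrow> H"
  shows "finsum G f S \<in> H"
  using assms(2)
proof (induction S rule: infinite_finite_induct)
  case (infinite S)
  with abelian_group.axioms(1)[OF assms(1)] show ?case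
    by (simp add: abelian_monoid.finsum_infinite)
next
  case empty
  with abelian_group.axioms(1)[OF assms(1)] show ?case
    by (simp add: abelian_monoid.finsum_empty)
next
  case (insert x S)
  then have "f \<in> S \<rightarrow> carrier G" "f x \<in> carrier G"
    using a_subset by auto
  with insert abelian_group.axioms(1)[OF assms(1)] show ?case
    by (simp add: abelian_monoid.finsum_insert)
qed

context K_algebra
begin

lemma lsmult_hom: "k \<in> carrier K \<Longrightarrow> abelian_group_hom A A (\<lambda>x. k \<odot> x)"
  by (intro abelian_group_hom_intro)
    (simp_all add: lsmult_closed lsmult_r_distr A.abelian_group_axioms)

lemma rsmult_hom: "k \<in> carrier K \<Longrightarrow> abelian_group_hom A A (\<lambda>x. x \<star> k)"
  by (intro abelian_group_hom_intro)
    (simp_all add: rsmult_closed rsmult_l_distr A.abelian_group_axioms)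

lemma lsmult_scalar_hom: "x \<in> carrier A \<Longrightarrow> abelian_group_hom K A (\<lambda>k. k \<odot> x)"
  by (intro abelian_group_hom_intro)
    (simp_all add: lsmult_closed lsmult_l_distr A.abelian_group_axioms K.is_abelian_group)

lemma lmult_hom: "a \<in> carrier A \<Longrightarrow> abelian_group_hom A A (\<lambda>x. a \<otimes> x)"
  by (intro abelian_group_hom_intro)
    (simp_all add: mult_closed mult_r_distr A.abelian_group_axioms)

lemma rmult_hom: "a \<in> carrier A \<Longrightarrow> abelian_group_hom A A (\<lambda>x. x \<otimes> a)"
  by (intro abelian_group_hom_intro)
    (simp_all add: mult_closed mult_l_distr A.abelian_group_axioms)

lemmas lsmult_zero_scalar [simp] = abelian_group_hom.hom_zero[OF lsmult_scalar_hom]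
lemmas lsmult_zero [simp] = abelian_group_hom.hom_zero[OF lsmult_hom]
lemmas mult_zero_left [simp] = abelian_group_hom.hom_zero[OF rmult_hom]
lemmas mult_zero_right [simp] = abelian_group_hom.hom_zero[OF lmult_hom]

lemma mult_minus_right:
  assumes "a \<in> carrier A" "x \<in> carrier A" "y \<in> carrier A"
  shows "a \<otimes> (x \<ominus> y) = a \<otimes> x \<ominus> a \<otimes> y"
  using assms abelian_group_hom.hom_a_inv[OF lmult_hom[OF assms(1)], of y]
  by (simp add: a_minus_def mult_r_distr)

section \<open>The quotient by the kernel\<close>

text \<open>All algebra axioms apart from closure and additive inverses are equations, and the
  latter are carried along as well, so everything passes from \<open>A\<close> to its image under
  \<open>F\<close>. It is applied with \<open>F\<close> running from \<open>A\<close> to the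
  quotient, so that the quotient inherits its laws from \<open>A\<close> and not from the
  convolution product.\<close>

lemma homomorphic_image:
  fixes Q :: "('k, 'c, 'q) bimodule_scheme"
  assumes car: "carrier Q = F ` carrier A" and z: "F \<zero> = \<zero>\<^bsub>Q\<^esub>"
    and ad: "\<And>x y. \<lbrakk>x \<in> carrier A; y \<in> carrier A\<rbrakk> \<Longrightarrow> F x \<oplus>\<^bsub>Q\<^esub> F y = F (x \<oplus> y)"
    and mu: "\<And>x y. \<lbrakk>x \<in> carrier A; y \<in> carrier A\<rbrakk> \<Longrightarrow> F x \<otimes>\<^bsub>Q\<^esub> F y = F (x \<otimes> y)"
    and ls: "\<And>k x. \<lbrakk>k \<in> carrier K; x \<in> carrier A\<rbrakk> \<Longrightarrow> k \<odot>\<^bsub>Q\<^esub> F x = F (k \<odot> x)"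
    and rs: "\<And>k x. \<lbrakk>k \<in> carrier K; x \<in> carrier A\<rbrakk> \<Longrightarrow> F x \<star>\<^bsub>Q\<^esub> k = F (x \<star> k)"
  shows "K_algebra K Q"
proof -
  note ops = z[symmetric] ad mu ls rs
  have "abelian_group Q"
  proof (rule abelian_groupI)
    fix x assume "x \<in> carrier Q"
    then obtain a where "a \<in> carrier A" "x = F a" by (auto simp: car)
    then have "F (\<ominus> a) \<in> carrier Q" "F (\<ominus> a) \<oplus>\<^bsub>Q\<^esub> x = \<zero>\<^bsub>Q\<^esub>"
      by (auto simp: car ops A.l_neg)
    then show "\<exists>y\<in>carrier Q. y \<oplus>\<^bsub>Q\<^esub> x = \<zero>\<^bsub>Q\<^esub>" by blast
  next
    fix x y assume "x \<in> carrier Q" "y \<in> carrier Q"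
    then obtain a b where "a \<in> carrier A" "b \<in> carrier A" "x = F a" "y = F b"
      by (auto simp: car)
    then show "x \<oplus>\<^bsub>Q\<^esub> y = y \<oplus>\<^bsub>Q\<^esub> x"
      using A.a_comm[of a b] by (simp add: ad)
  qed (auto simp: car ops A.a_assoc)
  then show ?thesis
    by (intro K_algebra.intro K_algebra_axioms.intro K.ring_axioms)
      (auto simp: car ops lsmult_closed lsmult_l_distr lsmult_r_distr lsmult_assoc lsmult_one
        rsmult_closed rsmult_r_distr rsmult_l_distr rsmult_assoc rsmult_one lsmult_rsmult
        mult_closed mult_l_distr mult_r_distr mult_assoc lsmult_mult rsmult_mult mult_rsmult)
qed

end

text \<open>The first isomorphism theorem. For the products and scalar actions of \<open>M\<close>
  only closure is assumed, no associativity or distributivity: cosets of the kernel are the fibres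
  of \<open>h\<close>, and the algebra laws come from \<open>A\<close> through the correspondence
  between its elements and these fibres.\<close>

lemma quotient_by_kernel:
  fixes M :: "('k, 'b, 'o) bimodule_scheme" and A :: "('k, 'a, 'n) bimodule_scheme"
  assumes "K_algebra K A" and "abelian_group_hom M A h"
    and cl: "\<And>x y. \<lbrakk>x \<in> carrier M; y \<in> carrier M\<rbrakk> \<Longrightarrow> x \<otimes>\<^bsub>M\<^esub> y \<in> carrier M"
      "\<And>k x. \<lbrakk>k \<in> carrier K; x \<in> carrier M\<rbrakk> \<Longrightarrow> k \<odot>\<^bsub>M\<^esub> x \<in> carrier M"
      "\<And>k x. \<lbrakk>k \<in> carrier K; x \<in> carrier M\<rbrakk> \<Longrightarrow> x \<star>\<^bsub>M\<^esub> k \<in> carrier M"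
    and hom: "\<And>x y. \<lbrakk>x \<in> carrier M; y \<in> carrier M\<rbrakk> \<Longrightarrow> h (x \<otimes>\<^bsub>M\<^esub> y) = h x \<otimes>\<^bsub>A\<^esub> h y"
      "\<And>k x. \<lbrakk>k \<in> carrier K; x \<in> carrier M\<rbrakk> \<Longrightarrow> h (k \<odot>\<^bsub>M\<^esub> x) = k \<odot>\<^bsub>A\<^esub> h x"
      "\<And>k x. \<lbrakk>k \<in> carrier K; x \<in> carrier M\<rbrakk> \<Longrightarrow> h (x \<star>\<^bsub>M\<^esub> k) = h x \<star>\<^bsub>A\<^esub> k"
    and onto: "h ` carrier M = carrier A"
    and Q_def: "Q = quotient_algebra M (a_kernel M A h)"
    and phi_def: "\<phi> = (\<lambda>X. the_elem (h ` X))"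
  shows "K_algebra_hom K Q A \<phi>" "bij_betw \<phi> (carrier Q) (carrier A)"
    and "x \<in> carrier M \<Longrightarrow> \<phi> (a_kernel M A h +>\<^bsub>M\<^esub> x) = h x"
proof -
  interpret alg: K_algebra K A by fact
  interpret h: abelian_group_hom M A h by fact
  \<comment> \<open>The fibre of \<open>h\<close> over \<open>a\<close>; as a map from
    \<open>A\<close> to the quotient it is the inverse of \<open>\<phi>\<close>.\<close>
  define F where "F a = {x \<in> carrier M. h x = a}" for a
  have ex: "\<exists>x\<in>carrier M. h x = a" if "a \<in> carrier A" for a
    using that onto by (metis imageE)
  have coset: "a_kernel M A h +>\<^bsub>M\<^esub> x = F (h x)" if x: "x \<in> carrier M" for x
  proof (intro equalityI subsetI)
    fix y assume "y \<in> a_kernel M A h +>\<^bsub>M\<^esub> x"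
    then obtain z where "z \<in> carrier M" "h z = \<zero>\<^bsub>A\<^esub>" "y = z \<oplus>\<^bsub>M\<^esub> x"
      unfolding a_r_coset_def' a_kernel_def' by blast
    with x show "y \<in> F (h x)" by (simp add: F_def)
  next
    fix y assume "y \<in> F (h x)"
    then have y: "y \<in> carrier M" "h y = h x" by (auto simp: F_def)
    have "y \<ominus>\<^bsub>M\<^esub> x \<in> a_kernel M A h"
      using x y alg.A.r_neg[of "h x"] unfolding a_kernel_def' a_minus_def by simp
    moreover have "(y \<ominus>\<^bsub>M\<^esub> x) \<oplus>\<^bsub>M\<^esub> x = y"
      using x y by (simp add: a_minus_def h.G.a_assoc h.G.l_neg)
    ultimately show "y \<in> a_kernel M A h +>\<^bsub>M\<^esub> x"
      unfolding a_r_coset_def' by (intro UN_I[of "y \<ominus>\<^bsub>M\<^esub> x"]) simp_all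
  qed
  \<comment> \<open>The quotient operations are unions over representatives. All the cosets united
    here coincide, and surjectivity of \<open>h\<close> makes the fibre nonempty, so that the union
    is this common coset and not the empty set.\<close>
  have un1: "(\<Union>x\<in>F a. a_kernel M A h +>\<^bsub>M\<^esub> g x) = F c"
    if "a \<in> carrier A" "\<And>x. x \<in> F a \<Longrightarrow> g x \<in> carrier M \<and> h (g x) = c" for a c g
  proof -
    have "F a \<noteq> {}" using ex[OF that(1)] by (auto simp: F_def)
    moreover have "a_kernel M A h +>\<^bsub>M\<^esub> g x = F c" if "x \<in> F a" for x
      using that \<open>\<And>x. x \<in> F a \<Longrightarrow> _\<close> coset by metis
    ultimately show ?thesis by auto
  qed
  have car: "carrier Q = F ` carrier A"
    by (auto simp: Q_def quotient_algebra_def A_RCOSETS_def' coset onto[symmetric])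
  have z: "F \<zero>\<^bsub>A\<^esub> = \<zero>\<^bsub>Q\<^esub>"
    unfolding Q_def quotient_algebra_def F_def a_kernel_def' by simp
  have ad: "F x \<oplus>\<^bsub>Q\<^esub> F y = F (x \<oplus>\<^bsub>A\<^esub> y)" if xy: "x \<in> carrier A" "y \<in> carrier A" for x y
  proof -
    \<comment> \<open>The inclusion that needs surjectivity: choose \<open>v\<close> over
      \<open>y\<close> and write \<open>w\<close> as the sum of its difference with \<open>v\<close>
      and \<open>v\<close> itself.\<close>
    have "w \<in> F x <+>\<^bsub>M\<^esub> F y" if w: "w \<in> carrier M" "h w = x \<oplus>\<^bsub>A\<^esub> y" for w
    proof -
      obtain v where v: "v \<in> carrier M" "h v = y" using ex xy by blast
      then have "w \<ominus>\<^bsub>M\<^esub> v \<in> F x"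
        using w xy by (simp add: F_def a_minus_def alg.A.a_assoc alg.A.r_neg)
      moreover have "(w \<ominus>\<^bsub>M\<^esub> v) \<oplus>\<^bsub>M\<^esub> v = w"
        using v w by (simp add: a_minus_def h.G.a_assoc h.G.l_neg)
      moreover have "v \<in> F y" using v by (simp add: F_def)
      ultimately show ?thesis 
        unfolding set_add_def' by (intro UN_I[of "w \<ominus>\<^bsub>M\<^esub> v"] UN_I[of v]) simp_all
    qed
    moreover have "F x <+>\<^bsub>M\<^esub> F y \<subseteq> F (x \<oplus>\<^bsub>A\<^esub> y)"
      by (auto simp: F_def set_add_def')
    ultimately have "F x <+>\<^bsub>M\<^esub> F y = F (x \<oplus>\<^bsub>A\<^esub> y)"
      unfolding F_def by blast
    then show ?thesis by (simp add: Q_def quotient_algebra_def)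
  qed
  have mu: "F x \<otimes>\<^bsub>Q\<^esub> F y = F (x \<otimes>\<^bsub>A\<^esub> y)" if "x \<in> carrier A" "y \<in> carrier A" for x y
  proof -
    have "(\<Union>v\<in>F y. a_kernel M A h +>\<^bsub>M\<^esub> u \<otimes>\<^bsub>M\<^esub> v) = F (x \<otimes>\<^bsub>A\<^esub> y)" if "u \<in> F x" for u
      using that by (intro un1 \<open>y \<in> carrier A\<close>) (auto simp: F_def cl hom)
    moreover have "F x \<noteq> {}" using ex[OF that(1)] by (auto simp: F_def)
    ultimately show ?thesis by (simp add: Q_def quotient_algebra_def rcoset_mult_def)
  qed
  have ls: "k \<odot>\<^bsub>Q\<^esub> F x = F (k \<odot>\<^bsub>A\<^esub> x)" if "k \<in> carrier K" "x \<in> carrier A" for k x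
    using that
    by (simp add: Q_def quotient_algebra_def) (rule un1, auto simp: F_def cl hom)
  have rs: "F x \<star>\<^bsub>Q\<^esub> k = F (x \<star>\<^bsub>A\<^esub> k)" if "k \<in> carrier K" "x \<in> carrier A" for k x
    using that
    by (simp add: Q_def quotient_algebra_def) (rule un1, auto simp: F_def cl hom)
  have phi: "\<phi> (F a) = a" if "a \<in> carrier A" for a
  proof -
    have "h ` F a = {a}" using ex[OF that] by (auto simp: F_def)
    then show ?thesis by (simp add: phi_def)
  qed
  have "K_algebra K Q"
    using car z ad mu ls rs by (rule alg.homomorphic_image)
  then show "K_algebra_hom K Q A \<phi>"
    by (intro K_algebra_hom.intro K_algebra_hom_axioms.intro alg.K_algebra_axioms)
      (auto simp: car phi ad mu ls rs alg.mult_closed alg.lsmult_closed alg.rsmult_closed)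
  show "bij_betw \<phi> (carrier Q) (carrier A)"
    by (intro bij_betw_byWitness[where f' = F]) (auto simp: car phi)
  show "\<phi> (a_kernel M A h +>\<^bsub>M\<^esub> x) = h x" if "x \<in> carrier M"
    using that by (simp add: coset phi)
qed

section \<open>The contracted algebra\<close>

lemma (in abelian_monoid) finsum_Times:
  assumes "finite S" "finite T" "\<And>a b. \<lbrakk>a \<in> S; b \<in> T\<rbrakk> \<Longrightarrow> f (a, b) \<in> carrier G"
  shows "finsum G f (S \<times> T) = (\<Oplus>a\<in>S. \<Oplus>b\<in>T. f (a, b))"
proof -
  have "(\<Oplus>b\<in>T. f (a, b)) = finsum G f ({a} \<times> T)" if "a \<in> S" for a
  proof -
    have "{a} \<times> T = Pair a ` T" by auto
    then show ?thesis
      using assms that by (simp add: finsum_reindex inj_on_def Pi_iff)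
  qed
  then have "(\<Oplus>a\<in>S. \<Oplus>b\<in>T. f (a, b)) = (\<Oplus>a\<in>S. finsum G f ({a} \<times> T))"
    using assms by (intro finsum_cong') (auto intro!: finsum_closed)
  also have "\<dots> = finsum G f (\<Union>a\<in>S. {a} \<times> T)"
    using assms by (intro add.finprod_UN_disjoint[symmetric]) (auto simp: pairwise_def disjnt_def)
  also have "(\<Union>a\<in>S. {a} \<times> T) = S \<times> T" by auto
  finally show ?thesis by simp
qed

lemma (in ring) contracted_abelian_group: "abelian_group (contracted_algebra R A B)"
proof (rule abelian_groupI)
  let ?M = "contracted_algebra R A B"
  show "f \<oplus>\<^bsub>?M\<^esub> g \<in> carrier ?M" if "f \<in> carrier ?M" "g \<in> carrier ?M" for f g
  proof -
    have "nonzero_support R (f \<oplus>\<^bsub>?M\<^esub> g) \<subseteq> nonzero_support R f \<union> nonzero_support R g"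
      by (auto simp: nonzero_support_def contracted_algebra_def)
    with that show ?thesis
      by (auto simp: contracted_algebra_def dest: finite_subset)
  qed
  show "\<exists>g\<in>carrier ?M. g \<oplus>\<^bsub>?M\<^esub> f = \<zero>\<^bsub>?M\<^esub>" if "f \<in> carrier ?M" for f
  proof
    from that have "nonzero_support R (\<lambda>x. \<ominus> f x) = nonzero_support R f"
      by (auto simp: contracted_algebra_def nonzero_support_def)
    with that show "(\<lambda>x. \<ominus> f x) \<in> carrier ?M"
      by (auto simp: contracted_algebra_def)
    show "(\<lambda>x. \<ominus> f x) \<oplus>\<^bsub>?M\<^esub> f = \<zero>\<^bsub>?M\<^esub>"
      using that by (auto simp: contracted_algebra_def l_neg)
  qed
qed (auto simp: contracted_algebra_def nonzero_support_def a_assoc intro!: ext a_comm)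

context boolean_cartan
begin

abbreviation M where "M \<equiv> contracted_algebra K A B"

sublocale M: abelian_group M
  by (rule K.contracted_abelian_group)

lemma M_simps:
  "f \<oplus>\<^bsub>M\<^esub> g = (\<lambda>x. f x \<oplus>\<^bsub>K\<^esub> g x)" "\<zero>\<^bsub>M\<^esub> = (\<lambda>x. \<zero>\<^bsub>K\<^esub>)"
  "k \<odot>\<^bsub>M\<^esub> f = (\<lambda>x. k \<otimes>\<^bsub>K\<^esub> f x)" "f \<star>\<^bsub>M\<^esub> k = (\<lambda>x. f x \<otimes>\<^bsub>K\<^esub> k)"
  by (simp_all add: contracted_algebra_def)

lemma M_carrier_iff:
  "f \<in> carrier M \<longleftrightarrow> (\<forall>x. f x \<in> carrier K) \<and> finite (nonzero_support K f) \<and>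
     nonzero_support K f \<subseteq> B - {\<zero>}"
  by (simp add: contracted_algebra_def)

lemma B_closed: "\<lbrakk>a \<in> B; b \<in> B\<rbrakk> \<Longrightarrow> a \<otimes> b \<in> B"
  using B.closed by simp

lemma B_carrier: "b \<in> B \<Longrightarrow> b \<in> carrier A"
  using B_subset by blast

lemma P_B: "p \<in> P \<Longrightarrow> p \<in> B"
  using B.proj_subset by auto

lemma M_closed:
  assumes "f \<in> carrier M"
  shows "f x \<in> carrier K" "finite (nonzero_support K f)"
    "x \<in> nonzero_support K f \<Longrightarrow> x \<in> B" "x \<in> nonzero_support K f \<Longrightarrow> x \<noteq> \<zero>"
    "x \<in> nonzero_support K f \<Longrightarrow> x \<in> carrier A"
  using assms B_subset by (auto simp: M_carrier_iff)

lemma M_lsmult_closed: "\<lbrakk>k \<in> carrier K; f \<in> carrier M\<rbrakk> \<Longrightarrow> k \<odot>\<^bsub>M\<^esub> f \<in> carrier M"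
proof -
  assume a: "k \<in> carrier K" "f \<in> carrier M"
  then have "nonzero_support K (k \<odot>\<^bsub>M\<^esub> f) \<subseteq> nonzero_support K f"
    by (auto simp: nonzero_support_def M_simps)
  with a show ?thesis
    unfolding M_carrier_iff by (auto simp: M_simps dest: finite_subset)
qed

lemma M_rsmult_closed: "\<lbrakk>k \<in> carrier K; f \<in> carrier M\<rbrakk> \<Longrightarrow> f \<star>\<^bsub>M\<^esub> k \<in> carrier M"
proof -
  assume a: "k \<in> carrier K" "f \<in> carrier M"
  then have "nonzero_support K (f \<star>\<^bsub>M\<^esub> k) \<subseteq> nonzero_support K f"
    by (auto simp: nonzero_support_def M_simps)
  with a show ?thesis
    unfolding M_carrier_iff by (auto simp: M_simps dest: finite_subset)
qed

lemma M_lsmult_hom: "k \<in> carrier K \<Longrightarrow> abelian_group_hom M M (\<lambda>f. k \<odot>\<^bsub>M\<^esub> f)"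
  by (intro abelian_group_hom_intro M.abelian_group_axioms M_lsmult_closed)
    (simp_all add: M_simps M_closed K.r_distr)

lemma delta_zero: "delta K A \<zero> = \<zero>\<^bsub>M\<^esub>"
  by (simp add: delta_def M_simps)

lemma delta_closed: "b \<in> B \<Longrightarrow> delta K A b \<in> carrier M"
  by (auto simp: delta_def M_carrier_iff nonzero_support_def intro: finite_subset[of _ "{b}"])

section \<open>The evaluation map from formal sums to \<open>A\<close>\<close>

definition ev where "ev f = (\<Oplus>b\<in>nonzero_support K f. f b \<odot> b)"

text \<open>Enlarging the index set only adds zero terms, so functions with different supports can
  be summed over a common set.\<close>

lemma ev_eq:
  assumes "f \<in> carrier M" "finite S" "nonzero_support K f \<subseteq> S" "S \<subseteq> carrier A"
  shows "ev f = (\<Oplus>b\<in>S. f b \<odot> b)"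
  unfolding ev_def using assms
  by (intro A.add.finprod_mono_neutral_cong_left)
    (auto simp: nonzero_support_def M_closed lsmult_closed)

lemma ev_closed: "f \<in> carrier M \<Longrightarrow> ev f \<in> carrier A"
  unfolding ev_def by (auto simp: M_closed intro!: A.finsum_closed lsmult_closed)

lemma ev_delta: "b \<in> B \<Longrightarrow> ev (delta K A b) = b"
proof -
  assume b: "b \<in> B"
  have "ev (delta K A b) = (\<Oplus>x\<in>{b}. delta K A b x \<odot> x)"
    using b B_subset by (intro ev_eq delta_closed) (auto simp: nonzero_support_def delta_def)
  also have "\<dots> = delta K A b b \<odot> b"
    using b B_carrier M_closed(1)[OF delta_closed[OF b], of b]
    by (simp add: A.finsum_insert A.finsum_empty lsmult_closed)
  also have "\<dots> = b"
    using b by (auto simp: delta_def lsmult_one B_carrier)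
  finally show ?thesis .
qed

lemma ev_hom: "abelian_group_hom M A ev"
proof (intro abelian_group_hom_intro M.abelian_group_axioms A.abelian_group_axioms ev_closed)
  fix f g assume fg: "f \<in> carrier M" "g \<in> carrier M"
  let ?S = "nonzero_support K f \<union> nonzero_support K g"
  have "ev (f \<oplus>\<^bsub>M\<^esub> g) = (\<Oplus>b\<in>?S. (f \<oplus>\<^bsub>M\<^esub> g) b \<odot> b)"
    using fg M_closed(2)[OF fg(1)] M_closed(2)[OF fg(2)] M_closed(5)
    by (intro ev_eq M.a_closed) (auto simp: M_simps nonzero_support_def)
  also have "\<dots> = (\<Oplus>b\<in>?S. f b \<odot> b \<oplus> g b \<odot> b)"
    using fg by (intro A.finsum_cong')
      (auto simp: M_simps M_closed intro!: lsmult_l_distr A.a_closed lsmult_closed)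
  also have "\<dots> = (\<Oplus>b\<in>?S. f b \<odot> b) \<oplus> (\<Oplus>b\<in>?S. g b \<odot> b)"
    using fg by (intro A.finsum_addf) (auto simp: M_closed lsmult_closed)
  also have "\<dots> = ev f \<oplus> ev g"
    using fg by (intro arg_cong2[where f = "add A"] ev_eq[symmetric]) (auto simp: M_closed)
  finally show "ev (f \<oplus>\<^bsub>M\<^esub> g) = ev f \<oplus> ev g" .
qed

lemma ev_lsmult:
  assumes "k \<in> carrier K" "f \<in> carrier M"
  shows "ev (k \<odot>\<^bsub>M\<^esub> f) = k \<odot> ev f"
proof -
  have "ev (k \<odot>\<^bsub>M\<^esub> f) = (\<Oplus>b\<in>nonzero_support K f. (k \<odot>\<^bsub>M\<^esub> f) b \<odot> b)"
    using assms M_closed(2)[OF assms(2)]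
    by (intro ev_eq M_lsmult_closed) (auto simp: M_closed M_simps nonzero_support_def)
  also have "\<dots> = (\<Oplus>b\<in>nonzero_support K f. k \<odot> (f b \<odot> b))"
    using assms
    by (intro A.finsum_cong') (auto simp: M_simps M_closed lsmult_closed lsmult_assoc)
  also have "\<dots> = k \<odot> ev f"
    unfolding ev_def using assms
    by (intro abelian_group_hom.hom_finsum[OF lsmult_hom, symmetric])
      (auto simp: M_closed lsmult_closed)
  finally show ?thesis .
qed

text \<open>Evaluation puts coefficients on the left; a right scalar reaches that side because
  elements of \<open>B\<close> commute with \<open>K\<close>.\<close>

lemma ev_rsmult:
  assumes "k \<in> carrier K" "f \<in> carrier M"
  shows "ev (f \<star>\<^bsub>M\<^esub> k) = ev f \<star> k"
proof -
  have "ev (f \<star>\<^bsub>M\<^esub> k) = (\<Oplus>b\<in>nonzero_support K f. (f \<star>\<^bsub>M\<^esub> k) b \<odot> b)"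
    using assms M_closed(2)[OF assms(2)]
    by (intro ev_eq M_rsmult_closed) (auto simp: M_closed M_simps nonzero_support_def)
  also have "\<dots> = (\<Oplus>b\<in>nonzero_support K f. (f b \<odot> b) \<star> k)"
    using assms
    by (intro A.finsum_cong')
      (auto simp: M_simps M_closed lsmult_closed rsmult_closed lsmult_assoc lsmult_rsmult rsmult_assoc
        B_scalar_comm)
  also have "\<dots> = ev f \<star> k"
    unfolding ev_def using assms
    by (intro abelian_group_hom.hom_finsum[OF rsmult_hom, symmetric])
      (auto simp: M_closed lsmult_closed)
  finally show ?thesis .
qed

text \<open>The scalar \<open>l\<close> crosses \<open>a\<close> in two moves: balancedness of the
  product turns it into a right scalar of \<open>a\<close>, and commutation of \<open>B\<close> with
  \<open>K\<close> turns that into a left scalar.\<close>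

lemma smult_mult_smult:
  assumes "k \<in> carrier K" "l \<in> carrier K" "a \<in> B" "b \<in> B"
  shows "(k \<odot> a) \<otimes> (l \<odot> b) = (k \<otimes>\<^bsub>K\<^esub> l) \<odot> (a \<otimes> b)"
proof -
  have "(k \<odot> a) \<otimes> (l \<odot> b) = k \<odot> ((a \<star> l) \<otimes> b)"
    using assms by (simp add: lsmult_mult rsmult_mult lsmult_closed B_carrier)
  also have "\<dots> = k \<odot> ((l \<odot> a) \<otimes> b)"
    using assms by (simp add: B_scalar_comm)
  also have "\<dots> = (k \<otimes>\<^bsub>K\<^esub> l) \<odot> (a \<otimes> b)"
    using assms by (simp add: lsmult_mult lsmult_assoc mult_closed B_carrier)
  finally show ?thesis .
qed

text \<open>Both sides are the sum of \<open>H\<close> over all pairs from the two supports.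
  Convolution groups these pairs by their product, and the pairs it discards have product zero and
  contribute nothing.\<close>

lemma ev_mult:
  assumes f: "f \<in> carrier M" and g: "g \<in> carrier M"
  shows "f \<otimes>\<^bsub>M\<^esub> g \<in> carrier M" "ev (f \<otimes>\<^bsub>M\<^esub> g) = ev f \<otimes> ev g"
proof -
  let ?S = "nonzero_support K f" and ?T = "nonzero_support K g"
  define fibre where "fibre c = {(a, b). a \<in> ?S \<and> b \<in> ?T \<and> a \<otimes> b = c}" for c
  \<comment> \<open>The nonzero products. The support of the convolution may be smaller, since
    coefficients can cancel.\<close>
  define C where "C = (\<lambda>(a, b). a \<otimes> b) ` (?S \<times> ?T) - {\<zero>}"
  define F where "F = (\<lambda>(a, b). f a \<otimes>\<^bsub>K\<^esub> g b)"
  define H where "H = (\<lambda>(a, b). (f a \<otimes>\<^bsub>K\<^esub> g b) \<odot> (a \<otimes> b))"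
  note fg = M_closed[OF f] M_closed[OF g]
  have fin: "finite (fibre c)" for c
    by (rule finite_subset[of _ "?S \<times> ?T"]) (auto simp: fibre_def fg)
  have C: "finite C" "C \<subseteq> B - {\<zero>}"
    using fg by (auto simp: C_def B_closed)
  have F: "F \<in> fibre c \<rightarrow> carrier K" for c
    by (auto simp: F_def fg)
  have val: "(f \<otimes>\<^bsub>M\<^esub> g) c = (if c \<in> B - {\<zero>} then finsum K F (fibre c) else \<zero>\<^bsub>K\<^esub>)" for c
    by (simp add: contracted_algebra_def F_def fibre_def)
  have supp: "nonzero_support K (f \<otimes>\<^bsub>M\<^esub> g) \<subseteq> C"
  proof
    fix c assume "c \<in> nonzero_support K (f \<otimes>\<^bsub>M\<^esub> g)"
    then have c: "c \<in> B - {\<zero>}" "finsum K F (fibre c) \<noteq> \<zero>\<^bsub>K\<^esub>"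
      by (auto simp: nonzero_support_def val split: if_splits)
    then have "fibre c \<noteq> {}" by (auto simp: K.finsum_empty)
    with c show "c \<in> C" by (force simp: C_def fibre_def)
  qed
  show cl: "f \<otimes>\<^bsub>M\<^esub> g \<in> carrier M"
    unfolding M_carrier_iff using supp C K.finsum_closed[OF F]
    by (auto simp: val dest: finite_subset)
  have Hcl: "H x \<in> carrier A" if "x \<in> ?S \<times> ?T" for x
    using that fg by (auto simp: H_def intro!: lsmult_closed mult_closed)
  have "ev (f \<otimes>\<^bsub>M\<^esub> g) = (\<Oplus>c\<in>C. (f \<otimes>\<^bsub>M\<^esub> g) c \<odot> c)"
    using supp C B_subset by (intro ev_eq cl) auto
  also have "\<dots> = (\<Oplus>c\<in>C. finsum A H (fibre c))"
  proof (rule A.finsum_cong')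
    fix c assume "c \<in> C"
    with C have c: "c \<in> B - {\<zero>}" by auto
    have "(f \<otimes>\<^bsub>M\<^esub> g) c \<odot> c = finsum K F (fibre c) \<odot> c"
      using c by (simp add: val)
    also have "\<dots> = (\<Oplus>x\<in>fibre c. F x \<odot> c)"
      using c B_carrier by (intro abelian_group_hom.hom_finsum[OF lsmult_scalar_hom] F) auto
    also have "\<dots> = finsum A H (fibre c)"
      using Hcl by (intro A.finsum_cong') (auto simp: fibre_def F_def H_def)
    finally show "(f \<otimes>\<^bsub>M\<^esub> g) c \<odot> c = finsum A H (fibre c)" .
  qed (use Hcl in \<open>auto simp: fibre_def intro!: A.finsum_closed\<close>)
  also have "\<dots> = finsum A H (\<Union>c\<in>C. fibre c)"
    using fin C Hcl by (intro A.add.finprod_UN_disjoint[symmetric])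
      (auto simp: pairwise_def disjnt_def fibre_def)
  also have "\<dots> = finsum A H (?S \<times> ?T)"
  proof (rule A.add.finprod_mono_neutral_cong_left)
    show "H i = \<zero>" if "i \<in> ?S \<times> ?T - (\<Union>c\<in>C. fibre c)" for i
      using that fg by (auto simp: H_def C_def fibre_def)
  qed (use fg Hcl in \<open>auto simp: fibre_def\<close>)
  also have "\<dots> = (\<Oplus>a\<in>?S. \<Oplus>b\<in>?T. H (a, b))"
    using fg Hcl by (intro A.finsum_Times) auto
  also have "\<dots> = (\<Oplus>a\<in>?S. (f a \<odot> a) \<otimes> ev g)"
  proof (rule A.finsum_cong')
    fix a assume a: "a \<in> ?S"
    have "(\<Oplus>b\<in>?T. H (a, b)) = (\<Oplus>b\<in>?T. (f a \<odot> a) \<otimes> (g b \<odot> b))"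
      using a fg by (intro A.finsum_cong')
        (auto simp: H_def smult_mult_smult intro!: lsmult_closed mult_closed)
    also have "\<dots> = (f a \<odot> a) \<otimes> ev g"
      unfolding ev_def using a fg
      by (intro abelian_group_hom.hom_finsum[OF lmult_hom, symmetric]) (auto intro!: lsmult_closed)
    finally show "(\<Oplus>b\<in>?T. H (a, b)) = (f a \<odot> a) \<otimes> ev g" .
  qed (use fg ev_closed[OF g] in \<open>auto intro!: mult_closed lsmult_closed\<close>)
  also have "\<dots> = ev f \<otimes> ev g"
    unfolding ev_def[of f] using fg ev_closed[OF g]
    by (intro abelian_group_hom.hom_finsum[OF rmult_hom, symmetric]) (auto intro!: lsmult_closed)
  finally show "ev (f \<otimes>\<^bsub>M\<^esub> g) = ev f \<otimes> ev g" .
qed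

end

section \<open>Sources, joins and differences\<close>

context restriction_semigroup
begin

lemma proj_carrier: "p \<in> P \<Longrightarrow> p \<in> carrier G"
  using proj_subset by blast

text \<open>If \<open>a = b \<otimes> p\<close> and \<open>b = a \<otimes> q\<close>, then
  \<open>p\<close> fixes \<open>a\<close>; as \<open>p\<close> and \<open>q\<close> commute,
  multiplying \<open>a\<close> by both gives \<open>b\<close> in one order and \<open>a\<close> in
  the other.\<close>

lemma le_antisym:
  assumes "a \<in> carrier G" "b \<in> carrier G" "rs_le G P a b" "rs_le G P b a"
  shows "a = b"
proof -
  obtain p q where pq: "p \<in> P" "q \<in> P" "a = b \<otimes> p" "b = a \<otimes> q"
    using assms(3,4) unfolding rs_le_def by blast
  have "(b \<otimes> p) \<otimes> p = b \<otimes> p"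
    using assms(2) pq(1) by (simp add: assoc proj_carrier proj_idem)
  with pq(3) have ap: "a \<otimes> p = a" by metis
  have "(a \<otimes> p) \<otimes> q = (a \<otimes> q) \<otimes> p"
    using assms(1) pq(1,2) by (simp add: assoc proj_carrier proj_comm)
  also have "\<dots> = a" by (metis pq(3,4))
  finally have "b = a" by (metis ap pq(4))
  then show ?thesis by simp
qed

lemma source_is_source:
  assumes "a \<in> carrier G" shows "is_source G P a (source G P a)"
proof -
  obtain p where p: "is_source G P a p" using source_exists assms by blast
  moreover have "q = p" if "is_source G P a q" for q
    using p that by (intro le_antisym) (auto simp: is_source_def proj_carrier)
  ultimately show ?thesis unfolding source_def by (rule theI)
qed

lemma source_proj_closed: "a \<in> carrier G \<Longrightarrow> source G P a \<in> P"
  and mult_source: "a \<in> carrier G \<Longrightarrow> a \<otimes> source G P a = a"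
  using source_is_source by (auto simp: is_source_def)

text \<open>Minimality of the source in multiplicative form, ready for rewriting.\<close>

lemma source_least:
  assumes "a \<in> carrier G" "q \<in> P" "a \<otimes> q = a"
  shows "q \<otimes> source G P a = source G P a"
proof -
  obtain r where "r \<in> P" "source G P a = q \<otimes> r"
    using source_is_source[OF assms(1)] assms by (auto simp: is_source_def rs_le_def)
  with assms(2) show ?thesis
    by (simp add: assoc[symmetric] proj_carrier proj_idem)
qed

lemma source_proj: "p \<in> P \<Longrightarrow> source G P p = p"
  using source_least[of p p] mult_source[of p] by (simp add: proj_carrier proj_idem)

text \<open>The projection witnessing \<open>a\<close> below \<open>c\<close> can always be taken to
  be the source of \<open>a\<close>, whatever \<open>c\<close> is. The second claim follows from
  minimality, because the source of \<open>c\<close> also fixes \<open>a\<close>.\<close>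

lemma le_source:
  assumes "a \<in> carrier G" "c \<in> carrier G" "rs_le G P a c"
  shows "c \<otimes> source G P a = a" "source G P c \<otimes> source G P a = source G P a"
proof -
  obtain p where p: "p \<in> P" "a = c \<otimes> p" using assms(3) unfolding rs_le_def by blast
  have "a \<otimes> p = a" using p assms(2) by (simp add: assoc proj_carrier proj_idem)
  then have "c \<otimes> source G P a = c \<otimes> (p \<otimes> source G P a)"
    using source_least assms p by simp
  also have "\<dots> = a \<otimes> source G P a" using p assms by (simp add: assoc proj_carrier source_proj_closed)
  finally show "c \<otimes> source G P a = a" using mult_source assms by simp
  have "a \<otimes> source G P c = c \<otimes> (source G P c \<otimes> p)"
    using p assms by (simp add: assoc proj_carrier source_proj_closed proj_comm)
  also have "\<dots> = a"
    using p assms by (simp add: assoc[symmetric] proj_carrier source_proj_closed mult_source)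
  finally show "source G P c \<otimes> source G P a = source G P a"
    using source_least assms source_proj_closed by blast
qed

end

context boolean_cartan
begin

abbreviation G where "G \<equiv> A\<lparr>carrier := B\<rparr>"
abbreviation s where "s \<equiv> source G P"
abbreviation le (infix \<open>\<preceq>\<close> 50) where "a \<preceq> b \<equiv> rs_le G P a b"

lemmas G_source_P = B.source_proj_closed[simplified]
lemmas G_mult_source = B.mult_source[simplified]
lemmas G_source_least = B.source_least[simplified]
lemmas G_le_source = B.le_source[simplified]
lemmas G_antisym = B.le_antisym[simplified]
lemmas G_proj_idem = B.proj_idem[simplified]
lemmas G_proj_comm = B.proj_comm[simplified]
lemmas G_proj_closed = B.proj_closed[simplified]

lemma le_iff: "a \<preceq> b \<longleftrightarrow> (\<exists>p\<in>P. a = b \<otimes> p)"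
  by (simp add: rs_le_def)

lemma P_carrier: "p \<in> P \<Longrightarrow> p \<in> carrier A"
  by (simp add: P_B B_carrier)

text \<open>Zero arises as the difference of a projection with itself. Some projection has to be
  given, as an empty \<open>B\<close> leaves \<open>P\<close> empty.\<close>

lemma zero_P: "p \<in> P \<Longrightarrow> \<zero> \<in> P"
proof -
  assume p: "p \<in> P"
  have "p \<preceq> p" unfolding le_iff by (rule bexI[OF _ p]) (simp add: G_proj_idem p)
  then have "p \<ominus> p \<in> P" using proj_diff p by blast
  then show ?thesis using P_carrier[OF p] by (simp add: a_minus_def A.r_neg)
qed

text \<open>A product of projections is its own source, and the source law identifies it with the
  source of \<open>a \<otimes> s b\<close>, which is the source of zero.\<close>

lemma orthogonal_source:
  assumes "a \<in> B" "b \<in> B" "a \<otimes> s b = \<zero>"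
  shows "s a \<otimes> s b = \<zero>"
proof -
  have "s a \<otimes> s b = s (s a \<otimes> s b)"
    using assms B.source_proj by (simp add: G_source_P G_proj_closed)
  also have "\<dots> = s (a \<otimes> s b)"
    using B.source_mult[of a "s b"] assms by (simp add: G_source_P P_B)
  also have "\<dots> = \<zero>"
    using B.source_proj zero_P G_source_P[of a] assms by simp
  finally show ?thesis .
qed

text \<open>De Morgan's law below \<open>r\<close>: the complements of \<open>p\<close> and
  \<open>q\<close> have product \<open>r\<close> minus \<open>p\<close> minus \<open>q\<close>, and
  the complement of that product is the sum. Only products and relative complements occur, under
  which \<open>P\<close> is closed.\<close>

lemma orthogonal_add_P:
  assumes P: "p \<in> P" "q \<in> P" "r \<in> P" and "r \<otimes> p = p" "r \<otimes> q = q" "p \<otimes> q = \<zero>"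
  shows "p \<oplus> q \<in> P"
proof -
  have diff: "r \<ominus> t \<in> P" if "t \<in> P" "r \<otimes> t = t" for t
  proof (rule proj_diff)
    show "t \<preceq> r" unfolding le_iff by (rule bexI[OF _ that(1)]) (simp add: that)
  qed (use that P in auto)
  note cl = P[THEN P_carrier]
  have 1: "r \<ominus> p \<in> P" "r \<ominus> q \<in> P" using diff assms by auto
  have "(r \<ominus> p) \<otimes> (r \<ominus> q) = (r \<ominus> p) \<otimes> r \<ominus> (r \<ominus> p) \<otimes> q"
    using cl by (simp add: mult_minus_right)
  also have "(r \<ominus> p) \<otimes> r = r \<otimes> (r \<ominus> p)" using 1 P G_proj_comm by blast
  also have "\<dots> = r \<ominus> p" using cl P assms by (simp add: mult_minus_right G_proj_idem)
  also have "(r \<ominus> p) \<otimes> q = q \<otimes> (r \<ominus> p)" using 1 P G_proj_comm by blast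
  also have "\<dots> = q"
    using cl P assms G_proj_comm[of q r] G_proj_comm[of q p]
    by (simp add: mult_minus_right) (simp add: a_minus_def)
  finally have "r \<ominus> (r \<ominus> p) \<otimes> (r \<ominus> q) = p \<oplus> q"
    using cl by (simp add: a_minus_def A.minus_add A.a_ac A.r_neg A.r_neg2 A.r_neg1)
  moreover have "r \<otimes> ((r \<ominus> p) \<otimes> (r \<ominus> q)) = (r \<ominus> p) \<otimes> (r \<ominus> q)"
    using cl P assms
    by (simp add: mult_assoc[symmetric]) (simp add: mult_minus_right G_proj_idem)
  ultimately show ?thesis
    using diff[OF G_proj_closed[OF 1]] by simp
qed

text \<open>The sum of the two sources is a projection, by De Morgan below the source of an upper
  bound. Multiplying any upper bound by it gives \<open>a \<oplus> b\<close>: one bound shows that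
  the sum lies in \<open>B\<close>, and letting the bound vary shows that the sum is least.\<close>

lemma orthogonal_join:
  assumes ab: "a \<in> B" "b \<in> B" "a \<otimes> s b = \<zero>" "bounded_pair G P a b"
  shows "a \<oplus> b \<in> B" "rs_join G P a b = a \<oplus> b"
proof -
  obtain c where c: "c \<in> B" "a \<preceq> c" "b \<preceq> c"
    using ab by (auto simp: bounded_pair_def)
  have sP: "s a \<in> P" "s b \<in> P" "s c \<in> P" using ab c by (auto simp: G_source_P)
  note cl = sP[THEN P_carrier] ab(1,2)[THEN B_carrier] c(1)[THEN B_carrier]
  have orth: "s a \<otimes> s b = \<zero>" "s b \<otimes> s a = \<zero>"
    using orthogonal_source ab G_proj_comm sP by auto
  have sum: "s a \<oplus> s b \<in> P"
    using orthogonal_add_P[OF sP] G_le_source(2) ab c orth by simp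
  have mult: "u \<otimes> (s a \<oplus> s b) = a \<oplus> b" if "u \<in> B" "a \<preceq> u" "b \<preceq> u" for u
    using that ab cl by (simp add: mult_r_distr B_carrier G_le_source(1))
  show mem: "a \<oplus> b \<in> B"
    using B_closed[OF c(1) P_B[OF sum]] mult[OF c] by simp
  have ca: "c \<otimes> s a = a" "c \<otimes> s b = b" using G_le_source(1) ab c by auto
  have "b \<otimes> s a = \<zero>"
    using mult_assoc[of c "s b" "s a"] cl ca orth by simp
  then have "a = (a \<oplus> b) \<otimes> s a" "b = (a \<oplus> b) \<otimes> s b"
    using cl ab by (simp_all add: mult_l_distr G_mult_source)
  with sP have up: "a \<preceq> a \<oplus> b" "b \<preceq> a \<oplus> b" unfolding le_iff by blast+
  have least: "a \<oplus> b \<preceq> u" if "u \<in> B" "a \<preceq> u" "b \<preceq> u" for u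
    using mult[OF that] sum unfolding le_iff by metis
  show "rs_join G P a b = a \<oplus> b"
    unfolding rs_join_def
  proof (rule the_equality)
    show "is_join G P a b (a \<oplus> b)"
      using mem up least by (simp add: is_join_def)
    show "j = a \<oplus> b" if "is_join G P a b j" for j
      using that mem up least by (intro G_antisym) (auto simp: is_join_def)
  qed
qed

text \<open>The relative complement \<open>r\<close> of the source of \<open>m\<close> in that of
  \<open>b\<close> cuts \<open>b \<ominus> m\<close> out of \<open>b\<close>. It annihilates
  \<open>m\<close>, and it absorbs the source of the difference, whence orthogonality;
  \<open>b\<close> itself is the common bound.\<close>

lemma difference:
  assumes "b \<in> B" "m \<in> B" "m \<preceq> b"
  shows "b \<ominus> m \<in> B" "m \<otimes> s (b \<ominus> m) = \<zero>" "bounded_pair G P m (b \<ominus> m)"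
proof -
  have sP: "s b \<in> P" "s m \<in> P" using assms by (auto simp: G_source_P)
  note cl = sP[THEN P_carrier] assms(1,2)[THEN B_carrier]
  note le = G_le_source[OF assms(2,1,3)]
  define r where "r = s b \<ominus> s m"
  have r: "r \<in> P" unfolding r_def
  proof (rule proj_diff)
    show "s m \<preceq> s b" unfolding le_iff by (rule bexI[OF _ sP(2)]) (simp add: le)
  qed (use sP in auto)
  have d: "b \<ominus> m = b \<otimes> r"
    using cl assms le by (simp add: r_def mult_minus_right G_mult_source)
  show dB: "b \<ominus> m \<in> B" using d B_closed P_B r assms by simp
  have "(b \<ominus> m) \<otimes> r = b \<ominus> m"
    using d cl r by (simp add: mult_assoc P_carrier G_proj_idem)
  then have sd: "r \<otimes> s (b \<ominus> m) = s (b \<ominus> m)"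
    using G_source_least dB r by blast
  have "s m \<otimes> r = \<zero>"
    using cl sP le(2) G_proj_comm[of "s m" "s b"]
    by (simp add: r_def mult_minus_right G_proj_idem) (simp add: a_minus_def A.r_neg)
  then have "m \<otimes> r = \<zero>"
    using mult_assoc[of m "s m" r] cl r assms by (simp add: P_carrier G_mult_source)
  then show "m \<otimes> s (b \<ominus> m) = \<zero>"
    using mult_assoc[of m r "s (b \<ominus> m)"] cl r dB sd by (simp add: P_carrier G_source_P)
  have "b \<ominus> m \<preceq> b" using d r unfolding le_iff by blast
  then show "bounded_pair G P m (b \<ominus> m)"
    using assms by (auto simp: bounded_pair_def)
qed

end

section \<open>The kernel of the evaluation map\<close>

text \<open>The span is an intersection; the assumption on the whole carrier puts it among the sets
  intersected, which keeps the span inside \<open>N\<close>.\<close>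

lemma K_span_sub_bimodule:
  assumes "abelian_group N" "S \<subseteq> carrier N" "sub_bimodule K N (carrier N)"
  shows "sub_bimodule K N (K_span K N S)" "S \<subseteq> K_span K N S"
proof -
  interpret N: abelian_group N by fact
  have grp: "additive_subgroup X N" if "sub_bimodule K N X" for X
    using that by (simp add: sub_bimodule_def)
  have "additive_subgroup (K_span K N S) N"
  proof (rule N.additive_subgroup_intro)
    show "K_span K N S \<subseteq> carrier N"
      using assms unfolding K_span_def by blast
    show "\<zero>\<^bsub>N\<^esub> \<in> K_span K N S"
      unfolding K_span_def using additive_subgroup.zero_closed[OF grp] by blast
    show "x \<oplus>\<^bsub>N\<^esub> y \<in> K_span K N S" if "x \<in> K_span K N S" "y \<in> K_span K N S" for x y
      using that unfolding K_span_def using additive_subgroup.a_closed[OF grp] by blast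
    show "\<ominus>\<^bsub>N\<^esub> x \<in> K_span K N S" if "x \<in> K_span K N S" for x
      using that unfolding K_span_def using additive_subgroup.a_inv_closed[OF grp] by blast
  qed
  then show "sub_bimodule K N (K_span K N S)"
    unfolding sub_bimodule_def K_span_def by blast
  show "S \<subseteq> K_span K N S" unfolding K_span_def by blast
qed

lemma K_span_least: "\<lbrakk>sub_bimodule K N X; S \<subseteq> X\<rbrakk> \<Longrightarrow> K_span K N S \<subseteq> X"
  unfolding K_span_def by blast

context boolean_cartan
begin

abbreviation I where "I \<equiv> join_ideal K A B P"

lemma M_eval_hom: "abelian_group_hom M K (\<lambda>f. f x)"
  by (intro abelian_group_hom_intro M.abelian_group_axioms K.is_abelian_group)
    (simp_all add: M_closed M_simps)

lemma sub_bimodule_M: "sub_bimodule K M (carrier M)"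
  unfolding sub_bimodule_def
  by (auto intro: M.additive_subgroup_intro M_lsmult_closed M_rsmult_closed)

text \<open>With joins rewritten as sums in \<open>A\<close>, the generators visibly evaluate to
  zero.\<close>

lemma I_eq:
  "I = K_span K M
     {delta K A a \<oplus>\<^bsub>M\<^esub> delta K A b \<ominus>\<^bsub>M\<^esub> delta K A (a \<oplus> b) | a b.
        a \<in> B - {\<zero>} \<and> b \<in> B - {\<zero>} \<and> a \<otimes> s b = \<zero> \<and> bounded_pair G P a b}"
proof -
  have "{delta K A a \<oplus>\<^bsub>M\<^esub> delta K A b \<ominus>\<^bsub>M\<^esub> delta K A (rs_join G P a b) | a b.
        a \<in> B - {\<zero>} \<and> b \<in> B - {\<zero>} \<and> a \<otimes> s b = \<zero> \<and> bounded_pair G P a b} =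
    {delta K A a \<oplus>\<^bsub>M\<^esub> delta K A b \<ominus>\<^bsub>M\<^esub> delta K A (a \<oplus> b) | a b.
        a \<in> B - {\<zero>} \<and> b \<in> B - {\<zero>} \<and> a \<otimes> s b = \<zero> \<and> bounded_pair G P a b}"
    using orthogonal_join(2) by (intro Collect_cong) (metis DiffD1)
  then show ?thesis by (simp add: join_ideal_def Let_def)
qed

lemma I_sub_bimodule: "sub_bimodule K M I"
  unfolding I_eq
  by (intro K_span_sub_bimodule M.abelian_group_axioms sub_bimodule_M)
    (auto intro!: M.a_closed M.minus_closed delta_closed orthogonal_join(1))

sublocale I: additive_subgroup I M
  using I_sub_bimodule by (simp add: sub_bimodule_def)

lemma I_subset_kernel: "I \<subseteq> a_kernel M A ev"
  unfolding I_eq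
proof (rule K_span_least)
  interpret ev: abelian_group_hom M A ev by (rule ev_hom)
  show "sub_bimodule K M (a_kernel M A ev)"
    unfolding sub_bimodule_def using ev.additive_subgroup_a_kernel
    unfolding a_kernel_def'
    by (auto simp: ev_lsmult ev_rsmult M_lsmult_closed M_rsmult_closed
      abelian_group_hom.hom_zero[OF rsmult_hom])
  have "ev (delta K A a \<oplus>\<^bsub>M\<^esub> delta K A b \<ominus>\<^bsub>M\<^esub> delta K A (a \<oplus> b)) = \<zero>"
    if "a \<in> B" "b \<in> B" "a \<oplus> b \<in> B" for a b
    using that by (simp add: a_minus_def delta_closed ev_delta A.r_neg B_carrier)
  then show "{delta K A a \<oplus>\<^bsub>M\<^esub> delta K A b \<ominus>\<^bsub>M\<^esub> delta K A (a \<oplus> b) | a b.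
        a \<in> B - {\<zero>} \<and> b \<in> B - {\<zero>} \<and> a \<otimes> s b = \<zero> \<and> bounded_pair G P a b} \<subseteq> a_kernel M A ev"
    unfolding a_kernel_def'
    by (auto intro!: M.a_closed M.minus_closed delta_closed orthogonal_join(1))
qed

lemma split_mem_I:
  assumes "b \<in> B" "m \<in> B" "m \<preceq> b"
  shows "delta K A m \<oplus>\<^bsub>M\<^esub> delta K A (b \<ominus> m) \<ominus>\<^bsub>M\<^esub> delta K A b \<in> I"
proof -
  note d = difference[OF assms] and cl = assms(1,2)[THEN B_carrier]
  have b: "m \<oplus> (b \<ominus> m) = b"
    using cl by (intro A.add_diff_cancel) simp_all
  \<comment> \<open>Generators of the ideal require both parts to be nonzero. In the two degenerate
    cases the expression itself vanishes, since the delta at zero is the zero function.\<close>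
  consider "m = \<zero>" | "b \<ominus> m = \<zero>" | "m \<noteq> \<zero>" "b \<ominus> m \<noteq> \<zero>" by blast
  then show ?thesis
  proof cases
    case 1
    then have "b \<ominus> m = b" using cl by (simp add: a_minus_def)
    with 1 assms(1) show ?thesis
      by (simp add: delta_zero delta_closed a_minus_def M.r_neg)
  next
    case 2
    then have "m = b" using b cl by simp
    with 2 assms(1) show ?thesis
      by (simp add: delta_zero delta_closed a_minus_def M.r_neg)
  next
    case 3
    have "delta K A m \<oplus>\<^bsub>M\<^esub> delta K A (b \<ominus> m) \<ominus>\<^bsub>M\<^esub> delta K A (m \<oplus> (b \<ominus> m)) \<in> I"
      unfolding I_eq using 3 d assms
      by (intro subsetD[OF K_span_sub_bimodule(2)] M.abelian_group_axioms sub_bimodule_M)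
        (auto intro!: M.a_closed M.minus_closed delta_closed orthogonal_join(1))
    then show ?thesis by (simp add: b)
  qed
qed

text \<open>The push-forward of \<open>f\<close> along \<open>g\<close>, that is, the linear
  extension of \<open>g\<close> on basis elements. Coefficients over the same image are added and
  may cancel, and terms sent to zero disappear.\<close>

definition push where
  "push g f = (\<Oplus>\<^bsub>M\<^esub>b\<in>nonzero_support K f. f b \<odot>\<^bsub>M\<^esub> delta K A (g b))"

context
  fixes f g
  assumes f: "f \<in> carrier M" and g: "\<And>b. b \<in> B \<Longrightarrow> g b \<in> B"
begin

lemma push_terms: "(\<lambda>b. f b \<odot>\<^bsub>M\<^esub> delta K A (g b)) \<in> nonzero_support K f \<rightarrow> carrier M"
  using f g by (auto intro!: M_lsmult_closed delta_closed simp: M_closed)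

lemma push_closed: "push g f \<in> carrier M"
  unfolding push_def using push_terms by (rule M.finsum_closed)

lemma push_apply:
  "push g f x = (\<Oplus>\<^bsub>K\<^esub>b\<in>nonzero_support K f. f b \<otimes>\<^bsub>K\<^esub> delta K A (g b) x)"
  unfolding push_def abelian_group_hom.hom_finsum[OF M_eval_hom push_terms]
  by (simp add: M_simps)

lemma ev_push: "ev (push g f) = (\<Oplus>b\<in>nonzero_support K f. f b \<odot> g b)"
  unfolding push_def abelian_group_hom.hom_finsum[OF ev_hom push_terms] using f g
  by (intro A.finsum_cong')
    (auto simp: ev_lsmult ev_delta delta_closed M_closed B_carrier intro!: lsmult_closed)

lemma support_push: "nonzero_support K (push g f) \<subseteq> g ` nonzero_support K f - {\<zero>}"
proof
  fix x assume x: "x \<in> nonzero_support K (push g f)"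
  have "\<exists>b\<in>nonzero_support K f. delta K A (g b) x \<noteq> \<zero>\<^bsub>K\<^esub>"
  proof (rule ccontr)
    assume "\<not> ?thesis"
    then have "push g f x = \<zero>\<^bsub>K\<^esub>"
      unfolding push_apply using f by (intro K.add.finprod_one_eqI) (auto simp: M_closed)
    with x show False by (simp add: nonzero_support_def)
  qed
  then show "x \<in> g ` nonzero_support K f - {\<zero>}"
    by (auto simp: delta_def split: if_splits)
qed

end

text \<open>Writes \<open>f\<close> as the sum of its terms, so that it can be compared termwise
  with its push-forwards.\<close>

lemma push_id: "f \<in> carrier M \<Longrightarrow> push (\<lambda>b. b) f = f"
proof
  fix x assume f: "f \<in> carrier M"
  have "push (\<lambda>b. b) f x =
      (\<Oplus>\<^bsub>K\<^esub>b\<in>nonzero_support K f. if b = x then f b else \<zero>\<^bsub>K\<^esub>)"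
    unfolding push_apply[OF f, of "\<lambda>b. b", simplified] using f
    by (intro K.finsum_cong') (auto simp: delta_def M_closed)
  also have "\<dots> = f x"
  proof (cases "x \<in> nonzero_support K f")
    case True
    then show ?thesis
      using f by (intro K.add.finprod_singleton_swap) (auto simp: M_closed)
  next
    case False
    then have "(\<Oplus>\<^bsub>K\<^esub>b\<in>nonzero_support K f. if b = x then f b else \<zero>\<^bsub>K\<^esub>) = \<zero>\<^bsub>K\<^esub>"
      by (intro K.add.finprod_one_eqI) auto
    then show ?thesis using False by (simp add: nonzero_support_def)
  qed
  finally show "push (\<lambda>b. b) f x = f x" .
qed

text \<open>Each basis element splits modulo the ideal by \<open>split_mem_I\<close>; multiplying by
  the coefficients and summing over the support gives the correction \<open>d\<close>.\<close>

lemma push_split_mem_I: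
  assumes f: "f \<in> carrier M" and g: "\<And>b. b \<in> B \<Longrightarrow> g b \<in> B" "\<And>b. b \<in> B \<Longrightarrow> g b \<preceq> b"
  shows "\<exists>d\<in>I. f \<oplus>\<^bsub>M\<^esub> d = push g f \<oplus>\<^bsub>M\<^esub> push (\<lambda>b. b \<ominus> g b) f"
proof -
  let ?S = "nonzero_support K f"
  let ?d = "\<lambda>b. delta K A b" and ?u = "\<lambda>b. delta K A (g b)" and ?v = "\<lambda>b. delta K A (b \<ominus> g b)"
  let ?w = "\<lambda>b. ?u b \<oplus>\<^bsub>M\<^esub> ?v b \<ominus>\<^bsub>M\<^esub> ?d b"
  define d where "d = (\<Oplus>\<^bsub>M\<^esub>b\<in>?S. f b \<odot>\<^bsub>M\<^esub> ?w b)"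
  have cl: "f b \<in> carrier K" "?d b \<in> carrier M" "?u b \<in> carrier M" "?v b \<in> carrier M"
    if "b \<in> ?S" for b
    using that f g by (auto simp: M_closed intro!: delta_closed difference(1))
  have "f b \<odot>\<^bsub>M\<^esub> ?w b \<in> I" if "b \<in> ?S" for b
    using split_mem_I[of b "g b"] I_sub_bimodule that f g
    unfolding sub_bimodule_def by (auto simp: M_closed)
  then have dI: "d \<in> I"
    unfolding d_def by (intro I.finsum_mem M.abelian_group_axioms) auto
  have split: "f b \<odot>\<^bsub>M\<^esub> ?d b \<oplus>\<^bsub>M\<^esub> f b \<odot>\<^bsub>M\<^esub> ?w b = f b \<odot>\<^bsub>M\<^esub> ?u b \<oplus>\<^bsub>M\<^esub> f b \<odot>\<^bsub>M\<^esub> ?v b"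
    if "b \<in> ?S" for b
  proof -
    interpret h: abelian_group_hom M M "\<lambda>x. f b \<odot>\<^bsub>M\<^esub> x"
      by (rule M_lsmult_hom) (rule cl[OF that])
    have "?d b \<oplus>\<^bsub>M\<^esub> ?w b = ?u b \<oplus>\<^bsub>M\<^esub> ?v b"
      using cl(2-)[OF that] by (intro M.add_diff_cancel) simp_all
    then show ?thesis
      using cl(2-)[OF that] h.hom_add[of "?d b" "?w b"] h.hom_add[of "?u b" "?v b"] by simp
  qed
  have lin: "f b \<odot>\<^bsub>M\<^esub> y \<in> carrier M" if "b \<in> ?S" "y \<in> carrier M" for b y
    using that cl by (intro M_lsmult_closed)
  have "push (\<lambda>b. b) f \<oplus>\<^bsub>M\<^esub> d = (\<Oplus>\<^bsub>M\<^esub>b\<in>?S. f b \<odot>\<^bsub>M\<^esub> ?d b \<oplus>\<^bsub>M\<^esub> f b \<odot>\<^bsub>M\<^esub> ?w b)"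
    unfolding push_def d_def using cl by (intro M.finsum_addf[symmetric]) (auto intro!: lin)
  also have "\<dots> = (\<Oplus>\<^bsub>M\<^esub>b\<in>?S. f b \<odot>\<^bsub>M\<^esub> ?u b \<oplus>\<^bsub>M\<^esub> f b \<odot>\<^bsub>M\<^esub> ?v b)"
    using cl by (intro M.finsum_cong' split) (auto intro!: lin M.a_closed)
  also have "\<dots> = push g f \<oplus>\<^bsub>M\<^esub> push (\<lambda>b. b \<ominus> g b) f"
    unfolding push_def using cl by (intro M.finsum_addf) (auto intro!: lin)
  finally show ?thesis
    using dI by (auto simp: push_id[OF f])
qed

lemma kernel_subset_I:
  assumes "f \<in> carrier M" "ev f = \<zero>"
  shows "f \<in> I"
proof -
  obtain meet where m:
      "\<forall>x\<in>carrier A. \<forall>b\<in>B. meet x b \<in> carrier A"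
      "\<forall>x\<in>carrier A. \<forall>y\<in>carrier A. \<forall>b\<in>B. meet (x \<oplus> y) b = meet x b \<oplus> meet y b"
      "\<forall>k\<in>carrier K. \<forall>x\<in>carrier A. \<forall>b\<in>B.
         meet (k \<odot> x) b = k \<odot> meet x b \<and> meet (x \<star> k) b = meet x b \<star> k"
      "\<forall>a\<in>B. \<forall>b\<in>B. is_max G P (meet a b) (down_set G P a \<inter> down_set G P b)"
    using meet_exists by (elim exE conjE) (rule that)
  note meet = m(1,2)[rule_format] m(3)[rule_format, THEN conjunct1] m(4)[rule_format]
  have meet_B: "meet b c \<in> B" and meet_le: "meet b c \<preceq> b" and meet_le2: "meet b c \<preceq> c"
    if "b \<in> B" "c \<in> B" for b c
    using meet(4)[OF that] by (auto simp: is_max_def down_set_def)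
  have refl: "c \<preceq> c" if "c \<in> B" for c
    using that G_mult_source G_source_P unfolding le_iff by metis
  have meet_absorb: "meet b c = c" if "b \<in> B" "c \<in> B" "c \<preceq> b" for b c
    using meet(4)[OF that(1,2)] that refl
    by (intro G_antisym) (auto simp: is_max_def down_set_def)
  define lower upper
    where "lower c = push (\<lambda>b. meet b c)" and "upper c = push (\<lambda>b. b \<ominus> meet b c)" for c
  let ?S = "nonzero_support K"
  have ker: "d \<in> carrier M" "ev d = \<zero>" if "d \<in> I" for d
    using that I_subset_kernel unfolding a_kernel_def' by auto
  interpret ev: abelian_group_hom M A ev by (rule ev_hom)
  have closed: "lower c f \<in> carrier M" "upper c f \<in> carrier M"
    and ev_lower: "ev (lower c f) = \<zero>"
    and lower_support: "?S (lower c f) \<subseteq> (\<lambda>b. meet b c) ` ?S f"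
    and upper_support: "card (?S (upper c f)) < card (?S f)"
    and split: "\<exists>d\<in>I. f \<oplus>\<^bsub>M\<^esub> d = lower c f \<oplus>\<^bsub>M\<^esub> upper c f"
    if f: "f \<in> carrier M" "ev f = \<zero>" and c: "c \<in> ?S f" for f c
  proof -
    have cB: "c \<in> B" using M_closed f c by blast
    have g: "meet b c \<in> B" "b \<ominus> meet b c \<in> B" if "b \<in> B" for b
      using that cB meet_B meet_le difference(1) by blast+
    show "lower c f \<in> carrier M" "upper c f \<in> carrier M"
      unfolding lower_def upper_def using g by (auto intro!: push_closed f)
    show "?S (lower c f) \<subseteq> (\<lambda>b. meet b c) ` ?S f"
      unfolding lower_def using support_push[OF f(1), of "\<lambda>b. meet b c"] g by blast
    show "\<exists>d\<in>I. f \<oplus>\<^bsub>M\<^esub> d = lower c f \<oplus>\<^bsub>M\<^esub> upper c f"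
      unfolding lower_def upper_def using g cB meet_le by (intro push_split_mem_I f) auto
    \<comment> \<open>Linearity takes the meet out of the finite sum, so the lower part evaluates to
      \<open>meet (ev f) c\<close>, which is the meet of zero with \<open>c\<close>.\<close>
    have "abelian_group_hom A A (\<lambda>x. meet x c)"
      using cB meet by (intro abelian_group_hom_intro A.abelian_group_axioms) auto
    then interpret m: abelian_group_hom A A "\<lambda>x. meet x c" .
    have "ev (lower c f) = (\<Oplus>b\<in>?S f. meet (f b \<odot> b) c)"
      unfolding lower_def using f g cB meet
      by (subst ev_push) (auto simp: M_closed intro!: A.finsum_cong' lsmult_closed)
    also have "\<dots> = meet (ev f) c"
      unfolding ev_def using f
      by (intro m.hom_finsum[symmetric]) (auto simp: M_closed intro!: lsmult_closed)
    also have "\<dots> = \<zero>" using f by simp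
    finally show "ev (lower c f) = \<zero>" .
    have "?S (upper c f) \<subseteq> (\<lambda>b. b \<ominus> meet b c) ` ?S f - {\<zero>}"
      unfolding upper_def using support_push[OF f(1), of "\<lambda>b. b \<ominus> meet b c"] g by blast
    \<comment> \<open>The term at \<open>c\<close> is lost because the meet of \<open>c\<close> with
      itself is \<open>c\<close>, which makes the difference zero.\<close>
    also have "\<dots> \<subseteq> (\<lambda>b. b \<ominus> meet b c) ` (?S f - {c})"
      using meet_absorb[OF cB cB refl[OF cB]] cB by (auto simp: a_minus_def A.r_neg B_carrier)
    finally have "card (?S (upper c f)) \<le> card (?S f - {c})"
      using f by (meson M_closed(2) card_image_le card_mono finite_Diff finite_imageI le_trans)
    also have "\<dots> < card (?S f)"
      using f c by (intro psubset_card_mono) (auto simp: M_closed)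
    finally show "card (?S (upper c f)) < card (?S f)" .
  qed
  show ?thesis using assms
  proof (induction "card (?S f)" arbitrary: f rule: less_induct)
    case less
    \<comment> \<open>The upper part is in the kernel, as \<open>f'\<close>, \<open>d\<close> and
      the lower part are, and it is covered by induction, so only the lower part is left to treat.
      The claim allows any \<open>f'\<close> with support as large as that of \<open>f\<close>,
      because \<open>lower c f\<close> also takes this role.\<close>
    have reduce: "f' \<in> I"
      if f': "card (?S f') = card (?S f)" "f' \<in> carrier M" "ev f' = \<zero>"
        and c: "c \<in> ?S f'" and low: "lower c f' \<in> I" for f' c
    proof -
      note cl = closed[OF f'(2,3) c]
      obtain d where d: "d \<in> I" "f' \<oplus>\<^bsub>M\<^esub> d = lower c f' \<oplus>\<^bsub>M\<^esub> upper c f'"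
        using split[OF f'(2,3) c] by blast
      have "ev (f' \<oplus>\<^bsub>M\<^esub> d) = \<zero>" using f' ker[OF d(1)] by simp
      then have "ev (upper c f') = \<zero>"
        unfolding d(2) using cl ev_lower[OF f'(2,3) c] by simp
      then have "upper c f' \<in> I"
        using less.hyps upper_support[OF f'(2,3) c] cl f'(1) by metis
      then have "(f' \<oplus>\<^bsub>M\<^esub> d) \<ominus>\<^bsub>M\<^esub> d \<in> I"
        unfolding d(2) using low d(1) by (simp add: a_minus_def)
      moreover have "(f' \<oplus>\<^bsub>M\<^esub> d) \<ominus>\<^bsub>M\<^esub> d = f'"
        using f' ker[OF d(1)] by (simp add: a_minus_def M.a_assoc M.r_neg)
      ultimately show ?thesis by simp
    qed
    \<comment> \<open>Meeting with \<open>c\<close> sends both \<open>b\<close> and \<open>c\<close>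
      to \<open>c\<close>; this collision makes the support of the lower part strictly
      smaller.\<close>
    have comparable: "f' \<in> I"
      if f': "card (?S f') = card (?S f)" "f' \<in> carrier M" "ev f' = \<zero>"
        and bc: "b \<in> ?S f'" "c \<in> ?S f'" "b \<noteq> c" "c \<preceq> b" for f' b c
    proof -
      have B: "b \<in> B" "c \<in> B" using M_closed f' bc by blast+
      have "meet b c = meet c c" using B bc refl meet_absorb by simp
      then have "(\<lambda>b. meet b c) ` ?S f' \<subseteq> (\<lambda>b. meet b c) ` (?S f' - {b})"
        using bc by blast
      then have "card (?S (lower c f')) \<le> card (?S f' - {b})"
        using lower_support[OF f'(2,3) bc(2)] M_closed(2)[OF f'(2)]
        by (meson card_image_le card_mono finite_Diff finite_imageI le_trans subset_trans)
      also have "\<dots> < card (?S f')"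
        using f' bc by (intro psubset_card_mono) (auto simp: M_closed)
      finally have "lower c f' \<in> I"
        using less.hyps[of "lower c f'"] f'(1) closed(1)[OF f'(2,3) bc(2)]
          ev_lower[OF f'(2,3) bc(2)] by simp
      then show ?thesis using reduce f' bc by blast
    qed
    show ?case
    proof (cases "?S f = {}")
      case True
      then have "f = \<zero>\<^bsub>M\<^esub>" by (auto simp: nonzero_support_def M_simps)
      then show ?thesis by simp
    next
      case False
      then obtain c where c: "c \<in> ?S f" by blast
      note f = less.prems
      have cB: "c \<in> B" using M_closed f c by blast
      note cl = closed(1)[OF f c] and evl = ev_lower[OF f c] and sup = lower_support[OF f c]
      have fin: "finite (?S f)" using f by (simp add: M_closed)
      show ?thesis
      proof (cases "card (?S (lower c f)) < card (?S f)")
        case True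
        then show ?thesis using less.hyps cl evl reduce f c by blast
      next
        case False
        moreover have "card ((\<lambda>b. meet b c) ` ?S f) \<le> card (?S f)"
          by (rule card_image_le[OF fin])
        \<comment> \<open>Without a drop in size, the meets with \<open>c\<close> are pairwise
          distinct over the support and all survive in the lower part.\<close>
        ultimately have eq: "?S (lower c f) = (\<lambda>b. meet b c) ` ?S f"
          using sup fin by (intro card_seteq) simp_all
        with False card_image_le[OF fin, of "\<lambda>b. meet b c"]
        have card: "card (?S (lower c f)) = card (?S f)" by simp
        have inj: "inj_on (\<lambda>b. meet b c) (?S f)"
          using eq card fin by (simp add: inj_on_iff_eq_card)
        have cc: "meet c c = c" using meet_absorb refl cB by blast
        show ?thesis
        proof (cases "?S f = {c}")
          case True
          \<comment> \<open>A single term cannot evaluate to zero, since nonzero scalars do not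
            annihilate nonzero elements of \<open>B\<close>; this case is contradictory.\<close>
          have "ev f = f c \<odot> c"
            unfolding ev_def True using f(1) cB
            by (simp add: A.finsum_insert A.finsum_empty M_closed lsmult_closed B_carrier)
          moreover have "f c \<noteq> \<zero>\<^bsub>K\<^esub>" "c \<noteq> \<zero>" "f c \<in> carrier K"
            using c f M_closed by (auto simp: nonzero_support_def)
          ultimately show ?thesis
            using scalar_mult_nonzero[of "f c" c] cB f(2) by simp
        next
          case False
          then obtain b where b: "b \<in> ?S f" "b \<noteq> c" using c by blast
          \<comment> \<open>Injectivity separates \<open>meet b c\<close> from
            \<open>meet c c\<close>, which is \<open>c\<close>. The lower part thus has two distinct
            comparable elements in its support, with \<open>c\<close> now the larger one.\<close>
          then have "meet b c \<noteq> c" using inj c cc by (metis inj_onD)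
          moreover have "meet b c \<in> ?S (lower c f)" "c \<in> ?S (lower c f)"
            unfolding eq using b c cc by (auto intro: rev_image_eqI)
          moreover have "meet b c \<preceq> c" using meet_le2 b cB f M_closed by blast
          ultimately have "lower c f \<in> I"
            using comparable[of "lower c f" c "meet b c"] card cl evl by metis
          then show ?thesis using reduce f c by blast
        qed
      qed
    qed
  qed
qed

section \<open>Kernel and image of evaluation, and uniqueness\<close>

lemma I_eq_kernel: "I = a_kernel M A ev"
  using I_subset_kernel kernel_subset_I unfolding a_kernel_def' by blast

text \<open>The induction principle for an algebra generated by \<open>B\<close>; it yields
  surjectivity of evaluation and uniqueness of the isomorphism.\<close>

lemma carrier_subset_subalgebra:
  assumes "sub_bimodule K A N" "\<And>x y. \<lbrakk>x \<in> N; y \<in> N\<rbrakk> \<Longrightarrow> x \<otimes> y \<in> N" "B \<subseteq> N"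
  shows "carrier A \<subseteq> N"
  using assms unfolding B_generates[symmetric] generated_subalgebra_def by blast

lemma ev_onto: "ev ` carrier M = carrier A"
proof
  interpret ev: abelian_group_hom M A ev by (rule ev_hom)
  show "ev ` carrier M \<subseteq> carrier A" by (auto simp: ev_closed)
  show "carrier A \<subseteq> ev ` carrier M"
  proof (rule carrier_subset_subalgebra)
    have "additive_subgroup (ev ` carrier M) A"
    proof (rule A.additive_subgroup_intro)
      show "\<zero> \<in> ev ` carrier M" by (rule image_eqI[of _ _ "\<zero>\<^bsub>M\<^esub>"]) simp_all
    qed (auto simp flip: ev.hom_add ev.hom_a_inv simp: ev_closed)
    then show "sub_bimodule K A (ev ` carrier M)"
      unfolding sub_bimodule_def
      by (auto simp flip: ev_lsmult ev_rsmult intro!: imageI M_lsmult_closed M_rsmult_closed)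
    show "x \<otimes> y \<in> ev ` carrier M" if "x \<in> ev ` carrier M" "y \<in> ev ` carrier M" for x y
      using that by (auto simp flip: ev_mult(2) intro!: imageI ev_mult(1))
    show "B \<subseteq> ev ` carrier M"
      using ev_delta delta_closed by (metis image_eqI subsetI)
  qed
qed

text \<open>The image under \<open>\<phi>\<close> of the set where the two maps agree is a
  subalgebra containing \<open>B\<close>, hence all of \<open>A\<close>. Injectivity of
  \<open>\<phi>\<close> brings this back to \<open>Q\<close>.\<close>

lemma hom_eq_on_generators:
  assumes "K_algebra_hom K Q A \<phi>" "K_algebra_hom K Q A \<psi>" "inj_on \<phi> (carrier Q)"
    and gen: "\<And>b. b \<in> B \<Longrightarrow> \<exists>X\<in>carrier Q. \<phi> X = b \<and> \<psi> X = b"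
    and "X \<in> carrier Q"
  shows "\<psi> X = \<phi> X"
proof -
  interpret \<phi>: K_algebra_hom K Q A \<phi> by fact
  interpret \<psi>: K_algebra_hom K Q A \<psi> by fact
  interpret p: abelian_group_hom Q A \<phi>
    using \<phi>.hom_closed \<phi>.hom_add
    by (intro abelian_group_hom_intro \<phi>.source.A.abelian_group_axioms A.abelian_group_axioms) auto
  interpret q: abelian_group_hom Q A \<psi>
    using \<psi>.hom_closed \<psi>.hom_add
    by (intro abelian_group_hom_intro \<phi>.source.A.abelian_group_axioms A.abelian_group_axioms) auto
  define E where "E = {X \<in> carrier Q. \<psi> X = \<phi> X}"
  have "carrier A \<subseteq> \<phi> ` E"
  proof (rule carrier_subset_subalgebra)
    have "additive_subgroup (\<phi> ` E) A"
    proof (rule A.additive_subgroup_intro)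
      show "\<zero> \<in> \<phi> ` E" by (rule image_eqI[of _ _ "\<zero>\<^bsub>Q\<^esub>"]) (simp_all add: E_def)
    qed (auto simp flip: p.hom_add p.hom_a_inv simp: E_def intro!: imageI)
    then show "sub_bimodule K A (\<phi> ` E)"
      unfolding sub_bimodule_def
      by (auto simp flip: \<phi>.hom_lsmult \<phi>.hom_rsmult intro!: imageI
        simp: E_def \<phi>.source.lsmult_closed \<phi>.source.rsmult_closed \<psi>.hom_lsmult \<psi>.hom_rsmult)
    show "x \<otimes> y \<in> \<phi> ` E" if "x \<in> \<phi> ` E" "y \<in> \<phi> ` E" for x y
      using that
      by (auto simp flip: \<phi>.hom_mult intro!: imageI simp: E_def \<phi>.source.mult_closed \<psi>.hom_mult)
    show "B \<subseteq> \<phi> ` E"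
      using gen unfolding E_def by force
  qed
  then have "\<phi> X \<in> \<phi> ` E"
    using assms(5) p.hom_closed by blast
  then have "X \<in> E"
    using assms(3,5) unfolding E_def by (auto dest: inj_onD)
  then show ?thesis by (simp add: E_def)
qed

end

theorem proposition8p5:
  fixes K :: "('k, 'm) ring_scheme"
    and A :: "('k, 'a, 'n) bimodule_scheme"
    and B P :: "'a set"
  assumes "boolean_cartan K A B P"
  shows "let M = contracted_algebra K A B; I = join_ideal K A B P in
    \<exists>\<phi>. K_algebra_hom K (quotient_algebra M I) A \<phi> \<and>
      bij_betw \<phi> (carrier (quotient_algebra M I)) (carrier A) \<and>
      (\<forall>b\<in>B. \<phi> (I +>\<^bsub>M\<^esub> delta K A b) = b) \<and>
      (\<forall>\<psi>. K_algebra_hom K (quotient_algebra M I) A \<psi> \<and>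
          (\<forall>b\<in>B. \<psi> (I +>\<^bsub>M\<^esub> delta K A b) = b) \<longrightarrow>
        (\<forall>X\<in>carrier (quotient_algebra M I). \<psi> X = \<phi> X))"
proof -
  interpret boolean_cartan K A B P by fact
  \<comment> \<open>Evaluation is constant on each coset of its kernel, so the image of a coset is a
    singleton.\<close>
  define \<phi> where "\<phi> = (\<lambda>X. the_elem (ev ` X))"
  let ?Q = "quotient_algebra M I"
  note quot = quotient_by_kernel[OF K_algebra_axioms ev_hom ev_mult(1) M_lsmult_closed
      M_rsmult_closed ev_mult(2) ev_lsmult ev_rsmult ev_onto refl \<phi>_def, folded I_eq_kernel]
  have hom: "K_algebra_hom K ?Q A \<phi>" and bij: "bij_betw \<phi> (carrier ?Q) (carrier A)"
    and coset: "\<And>x. x \<in> carrier M \<Longrightarrow> \<phi> (I +>\<^bsub>M\<^esub> x) = ev x"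
    using quot by blast+
  have delta: "\<phi> (I +>\<^bsub>M\<^esub> delta K A b) = b" if "b \<in> B" for b
    using that by (simp add: coset delta_closed ev_delta)
  have "\<psi> X = \<phi> X"
    if "K_algebra_hom K ?Q A \<psi>" "\<forall>b\<in>B. \<psi> (I +>\<^bsub>M\<^esub> delta K A b) = b" "X \<in> carrier ?Q" for \<psi> X
  proof (rule hom_eq_on_generators[OF hom that(1) bij_betw_imp_inj_on[OF bij] _ that(3)])
    fix b assume b: "b \<in> B"
    then have "I +>\<^bsub>M\<^esub> delta K A b \<in> carrier ?Q"
      unfolding quotient_algebra_def A_RCOSETS_def' by (auto intro: delta_closed)
    with b delta that(2) show "\<exists>X\<in>carrier ?Q. \<phi> X = b \<and> \<psi> X = b" by blast
  qed
  with hom bij delta show ?thesis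
    unfolding Let_def by blast
qed

end
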